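(* Fix $n\in\mathbb Z_{\ge2}$ and $k\in\mathbb Z_{\ge1}$, and let $\searrow_n=n(n-1)\cdots1$. Let $\Pi:\mathbb R^{\mathcal C_{n-1}(k)}\to\mathbb R^{\mathrm{Av}_k(\searrow_n)}$ be the linear map sending the basis vector indexed by $(\pi,\mathfrak c)\in\mathcal C_{n-1}(k)$ to the basis vector indexed by $\pi$ (the map forgetting colourings). Then $$P^{\mathrm{Av}(\searrow_n)}_k=\Pi\big(P(\mathcal{O}v_c(k,\searrow_n))\big),$$ where $\mathbb R^{\mathrm{Av}_k(\searrow_n)}$ is identified with the subspace of $\mathbb R^{\mathcal S_k}$ of vectors vanishing outside $\mathrm{Av}_k(\searrow_n)$.
   Context: For $I=\{i_1<\dots<i_m\}$, $\mathrm{pat}_I(\sigma)$ is the unique permutation of $[m]$ with entries in the same relative order as $\sigma(i_1),\dots,\sigma(i_m)$. $\sigma$ avoids $\pi$ if no $I$ has $\mathrm{pat}_I(\sigma)=\pi$; $\mathrm{Av}_m(\searrow_n)$ is the set of size-$m$ permutations avoiding $\searrow_n$ (with $\mathrm{Av}_0$ consisting of the empty permutation), $\mathrm{Av}(\searrow_n)=\bigcup_{m\ge1}\mathrm{Av}_m(\searrow_n)$. $\widetilde{\mathrm{c\text{-}occ}}(\pi,\sigma)$ for $\pi\in\mathcal S_k,\sigma\in\mathcal S_m$ is $1/m$ times the number of intervals $I=\{i,\dots,i+k-1\}$ with $\mathrm{pat}_I(\sigma)=\pi$. $P^{\mathrm{Av}(B)}_k$ is the set of $\vec v\in[0,1]^{\mathcal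 S_k}$ for which there is a sequence $(\sigma^m)$ in $\mathrm{Av}(B)$ with $|\sigma^m|\to\infty$ and $\widetilde{\mathrm{c\text{-}occ}}(\pi,\sigma^m)\to\vec v_\pi$ for all $\pi\in\mathcal S_k$. Colourings: a colouring of $\sigma\in\mathcal S_m$ is a map $\mathfrak c:[m]\to\mathbb Z_{\ge1}$ on indices; the pair $(\sigma,\mathfrak c)$ is a coloured permutation. Restriction: for $I=\{i_1<\dots<i_j\}$, $\mathrm{pat}_I(\sigma,\mathfrak c)=(\mathrm{pat}_I(\sigma),\mathfrak c')$ with $\mathfrak c'(\ell)=\mathfrak c(i_\ell)$; $\mathrm{be}_j(\cdot)=\mathrm{pat}_{\{1,\dots,j\}}(\cdot)$ and $\mathrm{en}_j(\cdot)=\mathrm{pat}_{\{m-j+1,\dots,m\}}(\cdot)$. The RITMO colouring $\mathbb C(\sigma)$ is defined by processing indices in decreasing order of value, giving each index $i$ the smallest positive integer $c$ such that no already coloured index $j<i$ (necessarily with $\sigma(j)>\sigma(i)$) has colour $c$; equivalently, colour 1 is given to the left-to-right maxima, colour 2 to the left-to-right maxima of the remaining entries, etc. Write $\mathbb S(\sigma)=(\sigma,\mathbb C(\sigma))$. For $\sigma\in\mathrm{Av}(\searrow_n)$, $\mathbb C(\sigma)$ takes values in $[n-1]$. A coloured permutation $(\pi,\mathfrak c)$ with $\pi\in\mathrm{Av}_k(\searrow_n)$ is an inherited colouring if there is $\sigma\in\mathrm{Av}(\searrow_n)$ with $|\sigma|\ge k$ and $\mathrm{en}_k(\mathbb S(\sigma))=(\pi,\mathfrak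 c)$. $\mathcal C_{n-1}(k)$ is the set of inherited colourings $(\pi,\mathfrak c)$ with $\pi\in\mathrm{Av}_k(\searrow_n)$ (their colours lie in $[n-1]$). Coloured overlap graph $\mathcal{O}v_c(k,\searrow_n)$: vertex set $\mathcal C_{n-1}(k-1)$, edge set $\mathcal C_{n-1}(k)$, the edge $(\pi,\mathfrak c)$ going from $\mathrm{be}_{k-1}(\pi,\mathfrak c)$ to $\mathrm{en}_{k-1}(\pi,\mathfrak c)$. A simple cycle is a closed walk with distinct edges and distinct vertices; for a nonempty cycle $\mathcal C$, $\vec e_{\mathcal C}\in\mathbb R^E$ has $e$-coordinate (number of occurrences of $e$ in $\mathcal C$)$/|\mathcal C|$; the cycle polytope $P(G)$ is the convex hull of $\vec e_{\mathcal C}$ over simple cycles. *)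

theory Defs
  imports "HOL-Analysis.Analysis"
begin

text \<open>Conventions. A permutation of [m] is a list of naturals containing each of 1..m exactly once.
Indices are 0-based internally. A coloured permutation is a pair (sigma, c) of lists of equal length,
c listing the colours of the indices.\<close>

definition perm_of :: "nat \<Rightarrow> nat list \<Rightarrow> bool" where
  "perm_of m \<sigma> \<longleftrightarrow> distinct \<sigma> \<and> set \<sigma> = {1..m}"

definition Sn :: "nat \<Rightarrow> nat list set" where
  "Sn m = {\<sigma>. perm_of m \<sigma>}"

definition std :: "nat list \<Rightarrow> nat list" where
  "std xs = map (\<lambda>x. card {y \<in> set xs. y \<le> x}) xs"

definition pat :: "nat set \<Rightarrow> nat list \<Rightarrow> nat list" where
  "pat I \<sigma> = std (nths \<sigma> I)"

definition avoids :: "nat list \<Rightarrow> nat list \<Rightarrow> bool" where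
  "avoids \<sigma> \<pi> \<longleftrightarrow> \<not> (\<exists>I. I \<subseteq> {..<length \<sigma>} \<and> pat I \<sigma> = \<pi>)"

definition dec :: "nat \<Rightarrow> nat list" where
  "dec n = rev [1..<n+1]"

definition Av :: "nat \<Rightarrow> nat \<Rightarrow> nat list set" where
  "Av n m = {\<sigma>. perm_of m \<sigma> \<and> avoids \<sigma> (dec n)}"

definition AvAll :: "nat \<Rightarrow> nat list set" where
  "AvAll n = (\<Union>m\<in>{1..}. Av n m)"

definition cocc :: "nat list \<Rightarrow> nat list \<Rightarrow> real" where
  "cocc \<pi> \<sigma> = real (card {i. i + length \<pi> \<le> length \<sigma> \<and>
       pat {i..<i + length \<pi>} \<sigma> = \<pi>}) / real (length \<sigma>)"

text \<open>The feasible region P^{Av(dec n)}_k; vectors in R^{S_k} are functions on lists vanishing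
outside S_k.\<close>
definition PAv :: "nat \<Rightarrow> nat \<Rightarrow> (nat list \<Rightarrow> real) set" where
  "PAv n k = {v. (\<forall>\<pi>. \<pi> \<notin> Sn k \<longrightarrow> v \<pi> = 0) \<and> (\<forall>\<pi>\<in>Sn k. 0 \<le> v \<pi> \<and> v \<pi> \<le> 1) \<and>
     (\<exists>s :: nat \<Rightarrow> nat list. (\<forall>m. s m \<in> AvAll n) \<and>
        filterlim (\<lambda>m. length (s m)) at_top sequentially \<and>
        (\<forall>\<pi>\<in>Sn k. (\<lambda>m. cocc \<pi> (s m)) \<longlonglongrightarrow> v \<pi>))}"

text \<open>RITMO colouring: indices processed in decreasing order of value; index i receives the
least positive colour not used by an index j < i with larger value.\<close>
function ritmo :: "nat list \<Rightarrow> nat \<Rightarrow> nat" where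
  "ritmo \<sigma> i = (LEAST c. 1 \<le> c \<and>
      c \<notin> ritmo \<sigma> ` {j. j < i \<and> j < length \<sigma> \<and> \<sigma> ! i < \<sigma> ! j})"
  by auto
termination
proof (relation "Wellfounded.measure (\<lambda>(\<sigma>, i). card {x \<in> set \<sigma>. \<sigma> ! i < x})")
  show "wf (Wellfounded.measure (\<lambda>(\<sigma>, i). card {x \<in> set \<sigma>. \<sigma> ! i < x}))"
    by (rule wf_measure)
next
  fix \<sigma> :: "nat list" and i j
  assume j: "j \<in> {j. j < i \<and> j < length \<sigma> \<and> \<sigma> ! i < \<sigma> ! j}"
  have sub: "{x \<in> set \<sigma>. \<sigma> ! j < x} \<subset> {x \<in> set \<sigma>. \<sigma> ! i < x}"
  proof
    show "{x \<in> set \<sigma>. \<sigma> ! j < x} \<subseteq> {x \<in> set \<sigma>. \<sigma> ! i < x}"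
      using j by auto
    have "\<sigma> ! j \<in> {x \<in> set \<sigma>. \<sigma> ! i < x}" using j by auto
    moreover have "\<sigma> ! j \<notin> {x \<in> set \<sigma>. \<sigma> ! j < x}" by simp
    ultimately show "{x \<in> set \<sigma>. \<sigma> ! j < x} \<noteq> {x \<in> set \<sigma>. \<sigma> ! i < x}" by blast
  qed
  have "card {x \<in> set \<sigma>. \<sigma> ! j < x} < card {x \<in> set \<sigma>. \<sigma> ! i < x}"
    by (rule psubset_card_mono[OF _ sub]) simp
  then show "((\<sigma>, j), \<sigma>, i) \<in> Wellfounded.measure (\<lambda>(\<sigma>, i). card {x \<in> set \<sigma>. \<sigma> ! i < x})"
    by simp
qed

type_synonym cperm = "nat list \<times> nat list"

definition SC :: "nat list \<Rightarrow> cperm" where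
  "SC \<sigma> = (\<sigma>, map (ritmo \<sigma>) [0..<length \<sigma>])"

definition be :: "nat \<Rightarrow> cperm \<Rightarrow> cperm" where
  "be j pc = (pat {0..<j} (fst pc), take j (snd pc))"

definition en :: "nat \<Rightarrow> cperm \<Rightarrow> cperm" where
  "en j pc = (pat {length (fst pc) - j..<length (fst pc)} (fst pc),
              drop (length (fst pc) - j) (snd pc))"

definition Cinh :: "nat \<Rightarrow> nat \<Rightarrow> cperm set" where
  "Cinh n k = {(\<pi>, c). \<pi> \<in> Av n k \<and>
      (\<exists>\<sigma>\<in>AvAll n. k \<le> length \<sigma> \<and> en k (SC \<sigma>) = (\<pi>, c))}"

text \<open>Coloured overlap graph: vertices Cinh n (k-1), edges Cinh n k, edge e from be_{k-1} e
to en_{k-1} e. A simple cycle is given by the list of its edges (in order).\<close>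
definition simple_cycle :: "nat \<Rightarrow> nat \<Rightarrow> cperm list \<Rightarrow> bool" where
  "simple_cycle n k es \<longleftrightarrow> es \<noteq> [] \<and> set es \<subseteq> Cinh n k \<and>
     set (map (be (k - 1)) es) \<subseteq> Cinh n (k - 1) \<and>
     (\<forall>i < length es. en (k - 1) (es ! i) = be (k - 1) (es ! ((i + 1) mod length es))) \<and>
     distinct es \<and> distinct (map (be (k - 1)) es)"

definition cycvec :: "cperm list \<Rightarrow> (cperm \<Rightarrow> real)" where
  "cycvec es = (\<lambda>e. real (count_list es e) / real (length es))"

definition cycle_polytope :: "nat \<Rightarrow> nat \<Rightarrow> (cperm \<Rightarrow> real) set" where
  "cycle_polytope n k = {w. \<exists>X \<mu>. finite X \<and> X \<subseteq> cycvec ` {es. simple_cycle n k es} \<and>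
      (\<forall>x\<in>X. 0 \<le> \<mu> x) \<and> sum \<mu> X = 1 \<and> w = (\<lambda>e. \<Sum>x\<in>X. \<mu> x * x e)}"

definition Pi_forget :: "nat \<Rightarrow> nat \<Rightarrow> (cperm \<Rightarrow> real) \<Rightarrow> (nat list \<Rightarrow> real)" where
  "Pi_forget n k w = (\<lambda>\<pi>. \<Sum>e\<in>{e \<in> Cinh n k. fst e = \<pi>}. w e)"

end

theory Submission
  imports Defs
begin

text \<open>
Scanning from left to right, a new entry gets RITMO colour c iff it exceeds all earlier entries of
colour c and is exceeded by some earlier entry of each colour below c. A colouring of this kind with
colours in [n-1] certifies avoidance of the decreasing pattern of length n.

The windows of a coloured permutation form a walk in the overlap graph, since prefixes inherit the
RITMO colouring. Along a subsequence the edge frequencies converge, and the limit is a circulation of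
mass 1, hence a convex combination of simple cycles.

Conversely, if a coloured word in which all n-1 colours occur ends in the source of an edge, then it
can be extended by one entry so that it ends in that edge: the entries that must lie below the new
one are all smaller than those that must lie above it. So every cycle can be traversed arbitrarily
often, and direct sums of the resulting permutations realise convex combinations.
\<close>

section \<open>Standardisation and RITMO colourings\<close>

text \<open>Appending an entry with a prescribed window pattern may complete a decreasing
  subsequence that starts far to the left of the window; the colours record what has to be known
  about that past. An edge is only known to end some word, and the word to be extended may have a
  different past, so the two pasts can be compared through colours and window alone. A new entry of
  colour \<open>C\<close> needs an earlier larger entry of every smaller colour, possibly outside
  the window; this is why all n-1 colours are made to occur from the start. Of each smaller colour
  only the latest entry matters, since it is the largest of its class. Words are lists of distinct
  naturals rather than permutations, so a value can be inserted by stretching the old values instead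
  of renumbering them. Realisability is stated by counts with an error bounded independently of a
  scale N; direct sums then simply add weights, and limits are taken only once.\<close>

definition order_iso :: "nat list \<Rightarrow> nat list \<Rightarrow> bool" where
  "order_iso xs ys \<longleftrightarrow> length xs = length ys \<and>
     (\<forall>i<length xs. \<forall>j<length xs. xs ! i < xs ! j \<longleftrightarrow> ys ! i < ys ! j)"

lemma order_iso_sym: "order_iso xs ys \<Longrightarrow> order_iso ys xs"
  by (auto simp: order_iso_def)

lemma order_iso_take: "order_iso xs ys \<Longrightarrow> order_iso (take j xs) (take j ys)"
  by (auto simp: order_iso_def)

lemma order_iso_drop: "order_iso xs ys \<Longrightarrow> order_iso (drop j xs) (drop j ys)"
  by (auto simp: order_iso_def)

lemma order_iso_map:
  assumes "\<And>x y. x < y \<Longrightarrow> f x < f y"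
  shows "order_iso (map f xs) xs"
  using assms by (auto simp: order_iso_def) (metis linorder_neqE_nat order_less_asym)

lemma order_iso_distinct:
  assumes "order_iso xs ys" "distinct xs"
  shows "distinct ys"
  using assms unfolding order_iso_def distinct_conv_nth
  by (metis linorder_neqE_nat order_less_irrefl)

lemma length_std [simp]: "length (std xs) = length xs"
  by (simp add: std_def)

lemma std_nth: "i < length xs \<Longrightarrow> std xs ! i = card {y \<in> set xs. y \<le> xs ! i}"
  by (simp add: std_def)

lemma std_less_iff:
  assumes "i < length xs" "j < length xs"
  shows "std xs ! i < std xs ! j \<longleftrightarrow> xs ! i < xs ! j"
proof
  assume l: "xs ! i < xs ! j"
  have "{y \<in> set xs. y \<le> xs ! i} \<subset> {y \<in> set xs. y \<le> xs ! j}"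
    using l assms by (auto simp: psubset_eq set_eq_iff intro: nth_mem)
      (metis leD nth_mem order_refl)
  then show "std xs ! i < std xs ! j"
    by (simp add: std_nth assms psubset_card_mono)
next
  assume "std xs ! i < std xs ! j"
  then have "\<not> card {y \<in> set xs. y \<le> xs ! j} \<le> card {y \<in> set xs. y \<le> xs ! i}"
    by (simp add: std_nth assms)
  then have "\<not> {y \<in> set xs. y \<le> xs ! j} \<subseteq> {y \<in> set xs. y \<le> xs ! i}"
    using card_mono[of "{y \<in> set xs. y \<le> xs ! i}"] by auto
  then show "xs ! i < xs ! j" by auto
qed

lemma order_iso_std: "order_iso (std xs) xs"
  by (simp add: order_iso_def std_less_iff)

lemma card_le_eq_card_index:
  assumes "distinct xs"
  shows "card {y \<in> set xs. y \<le> (x::nat)} = card {t. t < length xs \<and> xs ! t \<le> x}"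
proof -
  have "{y \<in> set xs. y \<le> x} = (\<lambda>t. xs ! t) ` {t. t < length xs \<and> xs ! t \<le> x}"
    by (auto simp: in_set_conv_nth)
  moreover have "inj_on (\<lambda>t. xs ! t) {t. t < length xs \<and> xs ! t \<le> x}"
    using assms by (auto simp: inj_on_def nth_eq_iff_index_eq)
  ultimately show ?thesis by (simp add: card_image)
qed

text \<open>\<open>std\<close> counts values, which the two lists need not share. Distinctness turns
  each count into a count of positions, and that set of positions depends only on the relative
  order.\<close>

lemma std_eq_if_order_iso:
  assumes "order_iso xs ys" "distinct xs"
  shows "std xs = std ys"
proof (rule nth_equalityI)
  show "length (std xs) = length (std ys)" using assms by (simp add: order_iso_def)
  fix i assume "i < length (std xs)"
  then have i: "i < length xs" "i < length ys" using assms by (auto simp: order_iso_def)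
  have "{t. t < length xs \<and> xs ! t \<le> xs ! i} = {t. t < length ys \<and> ys ! t \<le> ys ! i}"
    using assms i unfolding order_iso_def by (auto simp: not_less[symmetric])
  then show "std xs ! i = std ys ! i"
    using i assms order_iso_distinct[OF assms] by (simp add: std_nth card_le_eq_card_index)
qed

lemma std_eq_iff:
  assumes "distinct xs"
  shows "std xs = std ys \<longleftrightarrow> order_iso xs ys"
proof
  assume "std xs = std ys"
  then show "order_iso xs ys"
    using order_iso_std[of xs] order_iso_std[of ys] by (simp add: order_iso_def)
qed (simp add: std_eq_if_order_iso assms)

lemma distinct_std: "distinct xs \<Longrightarrow> distinct (std xs)"
  by (rule order_iso_distinct[OF order_iso_sym[OF order_iso_std]])

lemma std_take_std: "distinct xs \<Longrightarrow> std (take j (std xs)) = std (take j xs)"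
  by (intro std_eq_if_order_iso order_iso_take order_iso_std) (simp add: distinct_std)

lemma std_drop_std: "distinct xs \<Longrightarrow> std (drop j (std xs)) = std (drop j xs)"
  by (intro std_eq_if_order_iso order_iso_drop order_iso_std) (simp add: distinct_std)

lemma perm_of_std:
  assumes "distinct xs"
  shows "perm_of (length xs) (std xs)"
proof -
  have d: "distinct (std xs)" using assms by (rule distinct_std)
  have "set (std xs) \<subseteq> {1..length xs}"
  proof
    fix y assume "y \<in> set (std xs)"
    then obtain i where i: "i < length xs" "y = card {y \<in> set xs. y \<le> xs ! i}"
      by (auto simp: in_set_conv_nth std_nth)
    have "xs ! i \<in> {y \<in> set xs. y \<le> xs ! i}" using i by simp
    then have "y \<noteq> 0" unfolding i by (subst card_eq_0_iff) auto
    moreover have "y \<le> card (set xs)" unfolding i by (rule card_mono) auto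
    moreover have "card (set xs) \<le> length xs" by (rule card_length)
    ultimately show "y \<in> {1..length xs}" by auto
  qed
  moreover have "card (set (std xs)) = card {1..length xs}"
    using d by (simp add: distinct_card)
  ultimately have "set (std xs) = {1..length xs}" by (simp add: card_subset_eq)
  with d show ?thesis by (simp add: perm_of_def)
qed

lemma perm_of_length: "perm_of m xs \<Longrightarrow> length xs = m"
  unfolding perm_of_def by (metis card_atLeastAtMost diff_Suc_1 distinct_card)

lemma std_perm:
  assumes "perm_of m xs"
  shows "std xs = xs"
proof -
  have "card {y \<in> set xs. y \<le> x} = x" if "x \<in> set xs" for x
  proof -
    have "{y \<in> set xs. y \<le> x} = {1..x}" using assms that by (auto simp: perm_of_def)
    then show ?thesis by simp
  qed
  then show ?thesis unfolding std_def by (simp add: map_idI)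
qed

section \<open>Decreasing patterns and decreasing index sets\<close>

lemma length_dec [simp]: "length (dec n) = n"
  by (simp add: dec_def)

lemma dec_nth: "i < n \<Longrightarrow> dec n ! i = n - i"
  unfolding dec_def by (subst rev_nth) (auto simp del: upt_Suc)

lemma perm_of_dec: "perm_of n (dec n)"
  by (auto simp: perm_of_def dec_def)

lemma std_eq_dec_iff:
  assumes "distinct xs"
  shows "std xs = dec n \<longleftrightarrow>
    length xs = n \<and> (\<forall>i<n. \<forall>j<n. i < j \<longrightarrow> xs ! j < xs ! i)"
proof -
  have "std xs = dec n \<longleftrightarrow> order_iso xs (dec n)"
    using std_eq_iff[OF assms, of "dec n"] std_perm[OF perm_of_dec] by simp
  also have "\<dots> \<longleftrightarrow> length xs = n \<and> (\<forall>i<n. \<forall>j<n. i < j \<longrightarrow> xs ! j < xs ! i)"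
  proof
    assume "order_iso xs (dec n)"
    then show "length xs = n \<and> (\<forall>i<n. \<forall>j<n. i < j \<longrightarrow> xs ! j < xs ! i)"
      by (auto simp: order_iso_def dec_nth)
  next
    assume *: "length xs = n \<and> (\<forall>i<n. \<forall>j<n. i < j \<longrightarrow> xs ! j < xs ! i)"
    have "xs ! i < xs ! j \<longleftrightarrow> j < i" if "i < n" "j < n" for i j
      using * that by (metis linorder_neqE_nat order_less_asym)
    then show "order_iso xs (dec n)"
      using * by (auto simp: order_iso_def dec_nth)
  qed
  finally show ?thesis .
qed

lemma nths_conv_map_filter: "nths xs I = map ((!) xs) (filter (\<lambda>i. i \<in> I) [0..<length xs])"
proof -
  have "zip xs [0..<length xs] = map (\<lambda>i. (xs ! i, i)) [0..<length xs]"
    by (rule nth_equalityI) auto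
  then show ?thesis by (simp add: nths_def filter_map comp_def)
qed

lemma nths_interval: "nths xs {i..<i + k} = take k (drop i xs)"
proof -
  have "{i..<i + k} = (+) i ` {..<k}"
    by (simp add: lessThan_atLeast0 image_add_atLeastLessThan add.commute)
  then show ?thesis by (simp add: nths_drop[symmetric])
qed

text \<open>Decreasing subsequences are kept as index sets because these can be coloured, enlarged
  by one index and translated.\<close>

definition dec_on :: "nat list \<Rightarrow> nat set \<Rightarrow> bool" where
  "dec_on xs I \<longleftrightarrow> I \<subseteq> {..<length xs} \<and> (\<forall>i\<in>I. \<forall>j\<in>I. i < j \<longrightarrow> xs ! j < xs ! i)"

lemma avoids_dec_iff:
  assumes "distinct xs"
  shows "avoids xs (dec n) \<longleftrightarrow> (\<nexists>I. dec_on xs I \<and> card I = n)"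
proof -
  have "pat I xs = dec n \<longleftrightarrow> dec_on xs I \<and> card I = n" if I: "I \<subseteq> {..<length xs}" for I
  proof -
    \<comment> \<open>\<open>L\<close> enumerates \<open>I\<close> increasingly, so comparing
      positions in the pattern is the same as comparing members of \<open>I\<close>.\<close>
    define L where "L = filter (\<lambda>i. i \<in> I) [0..<length xs]"
    have L: "sorted_wrt (<) L" "distinct L" "set L = I"
      using I by (auto simp: L_def sorted_wrt_filter)
    have len: "length L = card I" using L distinct_card by force
    have "distinct (map ((!) xs) L)"
      using L I assms by (auto simp: distinct_map inj_on_def nth_eq_iff_index_eq subset_iff)
    then have "pat I xs = dec n \<longleftrightarrow>
      length L = n \<and> (\<forall>i<n. \<forall>j<n. i < j \<longrightarrow> xs ! (L ! j) < xs ! (L ! i))"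
      unfolding pat_def nths_conv_map_filter L_def[symmetric]
      by (subst std_eq_dec_iff) auto
    also have "\<dots> \<longleftrightarrow> length L = n \<and> (\<forall>i\<in>I. \<forall>j\<in>I. i < j \<longrightarrow> xs ! j < xs ! i)"
    proof (intro conj_cong refl iffI)
      assume *: "length L = n" "\<forall>i<n. \<forall>j<n. i < j \<longrightarrow> xs ! (L ! j) < xs ! (L ! i)"
      show "\<forall>i\<in>I. \<forall>j\<in>I. i < j \<longrightarrow> xs ! j < xs ! i"
      proof (intro ballI impI)
        fix i j assume "i \<in> I" "j \<in> I" "i < j"
        then obtain a b where ab: "a < n" "b < n" "i = L ! a" "j = L ! b"
          using L * by (metis in_set_conv_nth)
        then have "a < b"
          using \<open>i < j\<close> L * by (metis linorder_neqE_nat order_less_asym sorted_wrt_nth_less)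
        then show "xs ! j < xs ! i" using * ab by auto
      qed
    next
      assume *: "length L = n" "\<forall>i\<in>I. \<forall>j\<in>I. i < j \<longrightarrow> xs ! j < xs ! i"
      then show "\<forall>i<n. \<forall>j<n. i < j \<longrightarrow> xs ! (L ! j) < xs ! (L ! i)"
        using L by (metis nth_mem sorted_wrt_nth_less)
    qed
    finally show ?thesis using I len by (auto simp: dec_on_def)
  qed
  then show ?thesis by (auto simp: avoids_def dec_on_def)
qed

section \<open>RITMO colourings read from left to right\<close>

text \<open>Every clause looks only at earlier indices, so the property passes to prefixes and can
  be checked entry by entry as a word grows. The last clause expresses that the colour is least:
  each smaller colour is blocked by an earlier larger entry.\<close>

definition ritmo_coloured :: "nat list \<Rightarrow> nat list \<Rightarrow> bool" where
  "ritmo_coloured xs cs \<longleftrightarrow> length cs = length xs \<and>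
     (\<forall>i<length xs. 1 \<le> cs ! i \<and> (\<forall>j<i. cs ! j = cs ! i \<longrightarrow> xs ! j < xs ! i) \<and>
        (\<forall>c. 1 \<le> c \<longrightarrow> c < cs ! i \<longrightarrow> (\<exists>j<i. cs ! j = c \<and> xs ! i < xs ! j)))"

lemma ritmo_coloured_pos: "ritmo_coloured xs cs \<Longrightarrow> i < length xs \<Longrightarrow> 1 \<le> cs ! i"
  by (simp add: ritmo_coloured_def)

lemma ritmo_coloured_same:
  "ritmo_coloured xs cs \<Longrightarrow> i < length xs \<Longrightarrow> j < i \<Longrightarrow> cs ! j = cs ! i \<Longrightarrow> xs ! j < xs ! i"
  by (simp add: ritmo_coloured_def)

lemma ritmo_coloured_smaller:
  "ritmo_coloured xs cs \<Longrightarrow> i < length xs \<Longrightarrow> 1 \<le> c \<Longrightarrow> c < cs ! i \<Longrightarrow>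
    \<exists>j<i. cs ! j = c \<and> xs ! i < xs ! j"
  by (simp add: ritmo_coloured_def)

text \<open>If \<open>j\<close> has a strictly larger colour than \<open>i\<close>, minimality of
  that colour supplies an entry before \<open>j\<close> that has the colour of \<open>i\<close> and
  exceeds \<open>xs ! j\<close>; the increasing colour class of \<open>i\<close> puts this entry
  below \<open>xs ! i\<close>.\<close>

lemma ritmo_coloured_ge:
  assumes R: "ritmo_coloured xs cs" and i: "i < length xs" "j < i" "cs ! i \<le> cs ! j"
  shows "xs ! j < xs ! i"
proof (cases "cs ! j = cs ! i")
  case False
  then obtain j' where "j' < j" "cs ! j' = cs ! i" "xs ! j < xs ! j'"
    using ritmo_coloured_smaller[OF R, of j "cs ! i"] ritmo_coloured_pos[OF R] i by auto
  then show ?thesis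
    using ritmo_coloured_same[OF R, of i j'] i by auto
qed (use ritmo_coloured_same[OF R] i in auto)

declare ritmo.simps [simp del]

text \<open>Although \<open>ritmo\<close> terminates by descent through larger values, it consults
  only earlier indices, so induction on the index works.\<close>

lemma ritmo_coloured_unique:
  assumes R: "ritmo_coloured xs cs" and d: "distinct xs"
  shows "i < length xs \<Longrightarrow> ritmo xs i = cs ! i"
proof (induction i rule: less_induct)
  case (less i)
  have im: "ritmo xs ` {j. j < i \<and> j < length xs \<and> xs ! i < xs ! j} =
      (\<lambda>j. cs ! j) ` {j. j < i \<and> xs ! i < xs ! j}"
    using less by (intro image_cong) auto
  have "(LEAST c. 1 \<le> c \<and> c \<notin> (\<lambda>j. cs ! j) ` {j. j < i \<and> xs ! i < xs ! j}) = cs ! i"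
  proof (rule Least_equality)
    show "1 \<le> cs ! i \<and> cs ! i \<notin> (\<lambda>j. cs ! j) ` {j. j < i \<and> xs ! i < xs ! j}"
    proof
      show "1 \<le> cs ! i" by (rule ritmo_coloured_pos[OF R less.prems])
      show "cs ! i \<notin> (\<lambda>j. cs ! j) ` {j. j < i \<and> xs ! i < xs ! j}"
      proof
        assume "cs ! i \<in> (\<lambda>j. cs ! j) ` {j. j < i \<and> xs ! i < xs ! j}"
        then obtain j where j: "j < i" "xs ! i < xs ! j" "cs ! i = cs ! j" by blast
        have "xs ! j < xs ! i" by (rule ritmo_coloured_same[OF R less.prems j(1) j(3)[symmetric]])
        with j(2) show False by simp
      qed
    qed
    fix c assume c: "1 \<le> c \<and> c \<notin> (\<lambda>j. cs ! j) ` {j. j < i \<and> xs ! i < xs ! j}"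
    show "cs ! i \<le> c"
    proof (rule ccontr)
      assume "\<not> cs ! i \<le> c"
      then obtain j where "j < i" "cs ! j = c" "xs ! i < xs ! j"
        using ritmo_coloured_smaller[OF R less.prems, of c] c by auto
      then show False using c by blast
    qed
  qed
  then show ?case by (subst ritmo.simps) (simp only: im)
qed

lemma ritmo_coloured_ritmo:
  assumes d: "distinct xs"
  shows "ritmo_coloured xs (map (ritmo xs) [0..<length xs])"
proof -
  have "1 \<le> ritmo xs i \<and> (\<forall>j<i. ritmo xs j = ritmo xs i \<longrightarrow> xs ! j < xs ! i) \<and>
        (\<forall>c. 1 \<le> c \<longrightarrow> c < ritmo xs i \<longrightarrow> (\<exists>j<i. ritmo xs j = c \<and> xs ! i < xs ! j))"
    if i: "i < length xs" for i
  proof -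
    define P where "P = (\<lambda>c. 1 \<le> c \<and>
      c \<notin> ritmo xs ` {j. j < i \<and> j < length xs \<and> xs ! i < xs ! j})"
    have rP: "ritmo xs i = (LEAST c. P c)" by (subst ritmo.simps) (simp add: P_def)
    have "finite (insert 0 (ritmo xs ` {j. j < i \<and> j < length xs \<and> xs ! i < xs ! j}))" by simp
    then obtain c where "c \<notin> insert 0 (ritmo xs ` {j. j < i \<and> j < length xs \<and> xs ! i < xs ! j})"
      using ex_new_if_finite infinite_UNIV_nat by blast
    then have "P c" by (auto simp: P_def)
    then have P: "P (ritmo xs i)" unfolding rP by (rule LeastI)
    have least: "\<not> P c" if "c < ritmo xs i" for c
      using that unfolding rP by (rule not_less_Least)
    show ?thesis
    proof (intro conjI allI impI)
      show "1 \<le> ritmo xs i" using P by (simp add: P_def)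
      fix j assume "j < i" "ritmo xs j = ritmo xs i"
      then have "\<not> xs ! i < xs ! j" using P i unfolding P_def by (auto simp: image_iff)
      moreover have "xs ! i \<noteq> xs ! j" using d i \<open>j < i\<close> by (simp add: nth_eq_iff_index_eq)
      ultimately show "xs ! j < xs ! i" by simp
    next
      fix c assume "1 \<le> c" "c < ritmo xs i"
      then show "\<exists>j<i. ritmo xs j = c \<and> xs ! i < xs ! j"
        using least[of c] by (auto simp: P_def)
    qed
  qed
  moreover have "map (ritmo xs) [0..<length xs] ! i = ritmo xs i" if "i < length xs" for i
    using that by simp
  ultimately show ?thesis unfolding ritmo_coloured_def
    by (auto simp del: nth_map) (metis order_less_trans)+
qed

lemma ritmo_coloured_order_iso:
  assumes "order_iso xs ys" "ritmo_coloured xs cs"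
  shows "ritmo_coloured ys cs"
proof -
  have len: "length xs = length ys"
    and iff: "\<And>i j. j < i \<Longrightarrow> i < length xs \<Longrightarrow> xs ! j < xs ! i \<longleftrightarrow> ys ! j < ys ! i"
      "\<And>i j. j < i \<Longrightarrow> i < length xs \<Longrightarrow> xs ! i < xs ! j \<longleftrightarrow> ys ! i < ys ! j"
    using assms(1) by (auto simp: order_iso_def)
  show ?thesis
    using assms(2) iff unfolding ritmo_coloured_def len by blast
qed

lemma ritmo_coloured_take:
  assumes "ritmo_coloured xs cs"
  shows "ritmo_coloured (take j xs) (take j cs)"
proof -
  have "\<exists>j'<i. take j cs ! j' = c \<and> take j xs ! i < take j xs ! j'"
    if "i < length xs" "i < j" "1 \<le> c" "c < cs ! i" for i c
    using ritmo_coloured_smaller[OF assms, of i c] that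
    by (metis nth_take order_less_trans)
  then show ?thesis using assms unfolding ritmo_coloured_def by auto
qed

text \<open>Entries are arbitrary distinct naturals, so words can be extended and summed without
  renumbering; \<open>std\<close> returns to permutations when required. Positivity of the colours
  is part of \<open>ritmo_coloured\<close>, so they lie in [n-1].\<close>

definition ritmo_word :: "nat \<Rightarrow> nat list \<Rightarrow> nat list \<Rightarrow> bool" where
  "ritmo_word n xs cs \<longleftrightarrow> distinct xs \<and> ritmo_coloured xs cs \<and> set cs \<subseteq> {..<n}"

lemma ritmo_word_length: "ritmo_word n xs cs \<Longrightarrow> length cs = length xs"
  by (simp add: ritmo_word_def ritmo_coloured_def)

lemma ritmo_word_take: "ritmo_word n xs cs \<Longrightarrow> ritmo_word n (take j xs) (take j cs)"
  using set_take_subset[of j cs] by (auto simp: ritmo_word_def ritmo_coloured_take)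

lemma ritmo_word_order_iso: "order_iso xs ys \<Longrightarrow> ritmo_word n xs cs \<Longrightarrow> ritmo_word n ys cs"
  by (simp add: ritmo_word_def ritmo_coloured_order_iso[of xs ys] order_iso_distinct[of xs ys])

lemma ritmo_word_std: "ritmo_word n xs cs \<Longrightarrow> ritmo_word n (std xs) cs"
  by (rule ritmo_word_order_iso[OF order_iso_sym[OF order_iso_std]])

text \<open>Two positions of a decreasing subsequence cannot share a colour, and only n-1 colours
  are available.\<close>

lemma ritmo_word_avoids:
  assumes w: "ritmo_word n xs cs" and n: "1 \<le> n"
  shows "avoids xs (dec n)"
proof -
  have R: "ritmo_coloured xs cs" and d: "distinct xs" and s: "set cs \<subseteq> {..<n}"
    using w by (auto simp: ritmo_word_def)
  have False if I: "dec_on xs I" "card I = n" for I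
  proof -
    have Isub: "I \<subseteq> {..<length xs}" using I by (simp add: dec_on_def)
    have "cs ! i \<noteq> cs ! j" if "i \<in> I" "j \<in> I" "i < j" for i j
      using that I ritmo_coloured_same[OF R, of j i] by (force simp: dec_on_def)
    then have "inj_on (\<lambda>i. cs ! i) I" by (metis inj_onI linorder_neqE_nat)
    moreover have "(\<lambda>i. cs ! i) ` I \<subseteq> {1..<n}"
      using Isub s ritmo_coloured_pos[OF R] ritmo_word_length[OF w]
      by (force simp: subset_iff)
    ultimately have "card I \<le> card {1..<n}" by (rule card_inj_on_le) simp
    then show False using I n by simp
  qed
  then show ?thesis using avoids_dec_iff[OF d] by blast
qed

text \<open>Passing repeatedly to an earlier larger entry of the next smaller colour, down to colour
  1, traces a decreasing subsequence ending at \<open>i\<close>. The last two conclusions keep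
  \<open>i\<close> the rightmost and lowest member, so that the induction can attach the next
  index.\<close>

lemma ritmo_coloured_dec_on:
  assumes R: "ritmo_coloured xs cs"
  shows "i < length xs \<Longrightarrow> cs ! i = Suc m \<Longrightarrow>
    \<exists>I. dec_on xs I \<and> card I = Suc m \<and> I \<subseteq> {..i} \<and> (\<forall>j\<in>I. xs ! i \<le> xs ! j)"
proof (induction m arbitrary: i)
  case 0
  then show ?case by (intro exI[of _ "{i}"]) (auto simp: dec_on_def)
next
  case (Suc m)
  obtain j where j: "j < i" "cs ! j = Suc m" "xs ! i < xs ! j"
    using ritmo_coloured_smaller[OF R, of i "Suc m"] Suc.prems by auto
  then obtain I where I: "dec_on xs I" "card I = Suc m" "I \<subseteq> {..j}" "\<forall>t\<in>I. xs ! j \<le> xs ! t"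
    using Suc.IH[of j] Suc.prems by auto
  have "i \<notin> I" "finite I" using I j finite_subset by fastforce+
  have lt: "xs ! i < xs ! t" if "t \<in> I" for t using I j that order_less_le_trans by blast
  have lti: "t < i" if "t \<in> I" for t using I j that by (meson atMost_iff in_mono order_le_less_trans)
  have "dec_on xs (insert i I)"
    unfolding dec_on_def
  proof (intro conjI ballI impI)
    show "insert i I \<subseteq> {..<length xs}" using I Suc.prems by (simp add: dec_on_def)
    fix s t assume st: "s \<in> insert i I" "t \<in> insert i I" "s < t"
    then have "s \<in> I" using lti by force
    then show "xs ! t < xs ! s" using st I lt by (auto simp: dec_on_def)
  qed
  moreover have "card (insert i I) = Suc (Suc m)" using I \<open>i \<notin> I\<close> \<open>finite I\<close> by simp
  moreover have "insert i I \<subseteq> {..i}" using lti by force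
  moreover have "\<forall>t\<in>insert i I. xs ! i \<le> xs ! t" using lt by force
  ultimately show ?case by (intro exI[of _ "insert i I"] conjI)
qed

text \<open>Colour \<open>n\<close> would produce a decreasing subsequence of length
  \<open>n\<close>, and any colour above \<open>n\<close> forces an earlier entry of colour exactly
  \<open>n\<close>.\<close>

lemma avoids_ritmo_word:
  assumes d: "distinct xs" and a: "avoids xs (dec n)" and n: "1 \<le> n"
  shows "ritmo_word n xs (map (ritmo xs) [0..<length xs])"
proof -
  define cs where "cs = map (ritmo xs) [0..<length xs]"
  have R: "ritmo_coloured xs cs" unfolding cs_def by (rule ritmo_coloured_ritmo[OF d])
  then have len: "length cs = length xs" by (simp add: ritmo_coloured_def)
  have no: "cs ! i \<noteq> n" if "i < length xs" for i
    using ritmo_coloured_dec_on[OF R that, of "n - 1"] n a avoids_dec_iff[OF d] by force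
  have "cs ! i < n" if i: "i < length xs" for i
  proof (rule ccontr)
    assume "\<not> cs ! i < n"
    then have "n < cs ! i" using no[OF i] by simp
    then obtain j where "j < i" "cs ! j = n" using ritmo_coloured_smaller[OF R i n] by blast
    then show False using no[of j] i by simp
  qed
  then have "set cs \<subseteq> {..<n}" using len by (auto simp: in_set_conv_nth)
  then show ?thesis using R d by (simp add: ritmo_word_def cs_def)
qed

lemma std_ritmo_word_in_Av:
  assumes "ritmo_word n xs cs" "1 \<le> n"
  shows "std xs \<in> Av n (length xs)"
proof -
  have "distinct xs" using assms by (simp add: ritmo_word_def)
  then show ?thesis
    using ritmo_word_avoids[OF ritmo_word_std[OF assms(1)] assms(2)] perm_of_std[of xs]
    by (simp add: Av_def)
qed

section \<open>Windows of coloured words and inherited colourings\<close>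

definition window :: "nat \<Rightarrow> nat \<Rightarrow> nat list \<Rightarrow> nat list \<Rightarrow> cperm" where
  "window k i xs cs = (std (take k (drop i xs)), take k (drop i cs))"

lemma be_window:
  assumes "distinct xs" "j \<le> k"
  shows "be j (window k i xs cs) = window j i xs cs"
  using assms nths_interval[of "std (take k (drop i xs))" 0 j]
  by (simp add: be_def window_def pat_def std_take_std min_absorb1)

lemma en_eq:
  assumes "length (fst e) = length (snd e)" "j \<le> length (fst e)"
  shows "en j e = (std (drop (length (fst e) - j) (fst e)), drop (length (fst e) - j) (snd e))"
  using assms nths_interval[of "fst e" "length (fst e) - j" j]
  by (simp add: en_def pat_def)

lemma en_window:
  assumes "distinct xs" "length cs = length xs" "i + k \<le> length xs" "j \<le> k"
  shows "en j (window k i xs cs) = window j (i + k - j) xs cs"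
  using assms by (subst en_eq) (auto simp: window_def std_drop_std drop_take add.commute)

lemma window_std: "distinct xs \<Longrightarrow> window k i (std xs) cs = window k i xs cs"
  unfolding window_def
  using std_eq_if_order_iso[OF order_iso_take[OF order_iso_drop[OF order_iso_std]], of k i xs]
  by (simp add: distinct_std)

text \<open>Uniqueness identifies colours chosen by hand with the output of \<open>ritmo\<close>;
  this makes constructed words witnesses for inherited colourings.\<close>

lemma SC_std_ritmo_word:
  assumes "ritmo_word n xs cs"
  shows "SC (std xs) = (std xs, cs)"
proof -
  have w: "ritmo_word n (std xs) cs" using assms by (rule ritmo_word_std)
  then have "map (ritmo (std xs)) [0..<length (std xs)] = cs"
    using ritmo_coloured_unique[of "std xs" cs] ritmo_word_length[OF w]
    by (intro nth_equalityI) (auto simp: ritmo_word_def)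
  then show ?thesis by (simp add: SC_def)
qed

lemma final_window_in_Cinh:
  assumes w: "ritmo_word n xs cs" and k: "k \<le> length xs" "xs \<noteq> []" and n: "1 \<le> n"
  shows "window k (length xs - k) xs cs \<in> Cinh n k"
proof -
  have d: "distinct xs" and len: "length cs = length xs"
    using w by (auto simp: ritmo_word_def ritmo_coloured_def)
  have "window (length xs) 0 xs cs = (std xs, cs)" using len by (simp add: window_def)
  then have en: "en k (SC (std xs)) = window k (length xs - k) xs cs"
    using en_window[OF d len, of 0 "length xs" k] k by (simp add: SC_std_ritmo_word[OF w])
  have "std xs \<in> AvAll n"
    using std_ritmo_word_in_Av[OF w n] k by (auto simp: AvAll_def Suc_le_eq intro!: bexI[of _ "length xs"])
  moreover have "fst (window k (length xs - k) xs cs) \<in> Av n k"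
  proof -
    \<comment> \<open>The colours inherited by the window need not be its own RITMO colouring, so
      avoidance is taken from \<open>xs\<close> by translating index sets.\<close>
    have "avoids (drop (length xs - k) xs) (dec n)"
    proof -
      have False if I: "dec_on (drop (length xs - k) xs) I" "card I = n" for I
      proof -
        have "dec_on xs ((+) (length xs - k) ` I)"
          using I k by (fastforce simp: dec_on_def)
        moreover have "card ((+) (length xs - k) ` I) = n" using I by (simp add: card_image)
        ultimately show False using ritmo_word_avoids[OF w n] avoids_dec_iff[OF d] by blast
      qed
      then show ?thesis using avoids_dec_iff[of "drop (length xs - k) xs"] d by auto
    qed
    \<comment> \<open>The window is recoloured from scratch here, only to obtain membership of its
      pattern in \<open>Av\<close>.\<close>
    from std_ritmo_word_in_Av[OF avoids_ritmo_word[OF _ this n] n] show ?thesis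
      using d k by (simp add: window_def)
  qed
  ultimately show ?thesis using en k unfolding Cinh_def
    by (auto simp: case_prod_unfold intro!: bexI[of _ "std xs"])
qed

text \<open>Cutting the word right after the window does not change the remaining colours, so an
  inner window is the final window of a shorter word.\<close>

lemma window_in_Cinh:
  assumes w: "ritmo_word n xs cs" and k: "i + k \<le> length xs" "xs \<noteq> []" and n: "1 \<le> n"
  shows "window k i xs cs \<in> Cinh n k"
proof (cases "k = 0")
  \<comment> \<open>The cut could leave the empty word, which is not a witness. An empty window does
    not depend on its position, so the whole word is used instead.\<close>
  case True
  then show ?thesis using final_window_in_Cinh[OF w _ _ n, of k] k by (simp add: window_def)
next
  case False
  have "window k i xs cs = window k i (take (i + k) xs) (take (i + k) cs)"
    by (simp add: window_def drop_take)
  then show ?thesis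
    using final_window_in_Cinh[OF ritmo_word_take[OF w] _ _ n, of k "i + k"] k False
    by (simp add: min_absorb2)
qed

lemma CinhE:
  assumes "e \<in> Cinh n k" "1 \<le> n"
  obtains xs cs where "ritmo_word n xs cs" "k \<le> length xs" "xs \<noteq> []"
    "e = window k (length xs - k) xs cs"
proof -
  obtain \<sigma> m where \<sigma>: "\<sigma> \<in> Av n m" "1 \<le> m" "k \<le> length \<sigma>" "e = en k (SC \<sigma>)"
    using assms by (auto simp: Cinh_def AvAll_def)
  then have p: "perm_of m \<sigma>" "avoids \<sigma> (dec n)" by (auto simp: Av_def)
  define cs where "cs = map (ritmo \<sigma>) [0..<length \<sigma>]"
  have w: "ritmo_word n \<sigma> cs"
    unfolding cs_def using p assms by (intro avoids_ritmo_word) (auto simp: perm_of_def)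
  have d: "distinct \<sigma>" using p by (simp add: perm_of_def)
  have "SC \<sigma> = window (length \<sigma>) 0 \<sigma> cs"
    using std_perm[OF p(1)] by (simp add: SC_def window_def cs_def)
  then have "e = window k (length \<sigma> - k) \<sigma> cs"
    using en_window[OF d, of cs 0 "length \<sigma>" k] \<sigma> by (simp add: cs_def)
  moreover have "\<sigma> \<noteq> []" using perm_of_length[OF p(1)] \<sigma> by auto
  ultimately show ?thesis using that w \<sigma> by blast
qed

lemma Cinh_fst_in_Sn: "e \<in> Cinh n k \<Longrightarrow> fst e \<in> Sn k"
  by (auto simp: Cinh_def Av_def Sn_def)

lemma finite_Cinh:
  assumes "1 \<le> n"
  shows "finite (Cinh n k)"
proof -
  have "Cinh n k \<subseteq> {xs. set xs \<subseteq> {1..k} \<and> length xs = k} \<times> {cs. set cs \<subseteq> {..<n} \<and> length cs = k}"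
  proof
    fix e assume e: "e \<in> Cinh n k"
    obtain xs cs where x: "ritmo_word n xs cs" "k \<le> length xs" "e = window k (length xs - k) xs cs"
      using CinhE[OF e assms] .
    then have "set (snd e) \<subseteq> {..<n}" "length (snd e) = k"
      using ritmo_word_length[OF x(1)]
      by (auto simp: window_def ritmo_word_def dest: in_set_takeD in_set_dropD)
    moreover have "set (fst e) \<subseteq> {1..k}" "length (fst e) = k"
      using Cinh_fst_in_Sn[OF e] perm_of_length by (auto simp: Sn_def perm_of_def)
    ultimately show "e \<in> {xs. set xs \<subseteq> {1..k} \<and> length xs = k} \<times> {cs. set cs \<subseteq> {..<n} \<and> length cs = k}"
      by (auto simp: mem_Times_iff)
  qed
  then show ?thesis by (rule finite_subset) (simp add: finite_lists_length_eq)
qed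

section \<open>Extending coloured words along edges\<close>

text \<open>Relabelling \<open>x\<close> as \<open>2 * x + 1\<close> frees all even values, so there
  is room between any two consecutive old values. \<open>2 * Max L + 2\<close> is the first even
  value above the images of \<open>L\<close>; for empty \<open>L\<close> the value 0 is below every
  odd number.\<close>

lemma exists_between_doubled:
  fixes L H :: "nat set"
  assumes "finite L" "\<And>l h. l \<in> L \<Longrightarrow> h \<in> H \<Longrightarrow> l < h"
  shows "\<exists>v. even v \<and> (\<forall>l\<in>L. 2 * l + 1 < v) \<and> (\<forall>h\<in>H. v < 2 * h + 1)"
proof (cases "L = {}")
  case True
  then show ?thesis by (intro exI[of _ 0]) auto
next
  case False
  have "2 * l + 1 < 2 * Max L + 2" if "l \<in> L" for l
    using Max_ge[OF assms(1) that] by simp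
  moreover have "2 * Max L + 2 < 2 * h + 1" if "h \<in> H" for h
    using assms(2)[OF Max_in[OF assms(1) False] that] by simp
  ultimately show ?thesis by (intro exI[of _ "2 * Max L + 2"]) auto
qed

lemma order_iso_snoc:
  assumes "order_iso xs ys" "\<And>i. i < length xs \<Longrightarrow> xs ! i < x \<longleftrightarrow> ys ! i < y"
    "\<And>i. i < length xs \<Longrightarrow> x < xs ! i \<longleftrightarrow> y < ys ! i"
  shows "order_iso (xs @ [x]) (ys @ [y])"
  using assms unfolding order_iso_def by (auto simp: nth_append less_Suc_eq)

text \<open>
Here \<open>latest c\<close> is the last index of colour c. The new entry must exceed every \<open>l\<close> (colour
classes increase, window pattern) and stay below every \<open>u\<close> (smaller colours are needed above it,
window pattern).
\<close>
lemma extension_cut: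
  assumes R: "ritmo_coloured xs cs" and R': "ritmo_coloured ys ds"
    and p: "length xs = A + h" and q: "length ys = Suc (B + h)"
    and ord: "\<And>s t. s < h \<Longrightarrow> t < h \<Longrightarrow> xs ! (A + s) < xs ! (A + t) \<longleftrightarrow> ys ! (B + s) < ys ! (B + t)"
    and col: "\<And>t. t < h \<Longrightarrow> cs ! (A + t) = ds ! (B + t)"
    and latest: "\<And>c. 1 \<le> c \<Longrightarrow> c < ds ! (B + h) \<Longrightarrow> latest c < length xs \<and> cs ! latest c = c"
    and latest_max: "\<And>c j. 1 \<le> c \<Longrightarrow> c < ds ! (B + h) \<Longrightarrow> j < length xs \<Longrightarrow> cs ! j = c \<Longrightarrow> j \<le> latest c"
    and l: "l \<in> {xs ! j | j. j < length xs \<and> cs ! j = ds ! (B + h)} \<union>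
        {xs ! (A + t) | t. t < h \<and> ys ! (B + t) < ys ! (B + h)}"
    and u: "u \<in> {xs ! latest c | c. 1 \<le> c \<and> c < ds ! (B + h)} \<union>
        {xs ! (A + t) | t. t < h \<and> ys ! (B + h) < ys ! (B + t)}"
  shows "l < u"
proof -
  define C where "C = ds ! (B + h)"
  define X where "X = ys ! (B + h)"
  note latest = latest[folded C_def] and latest_max = latest_max[folded C_def]
  \<comment> \<open>Colour classes increase, so the latest entry of a class is its largest.\<close>
  have le_latest: "xs ! j \<le> xs ! latest c" if "1 \<le> c" "c < C" "j < length xs" "cs ! j = c" for j c
  proof (cases "j = latest c")
    case False
    then have "j < latest c" using latest_max[OF that] by simp
    then show ?thesis
      using ritmo_coloured_same[OF R, of "latest c" j] latest[OF that(1,2)] that by simp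
  qed simp
  consider (cc) j c where "j < length xs" "cs ! j = C" "l = xs ! j" "1 \<le> c" "c < C" "u = xs ! latest c"
    | (cw) j t where "j < length xs" "cs ! j = C" "l = xs ! j" "t < h" "X < ys ! (B + t)" "u = xs ! (A + t)"
    | (wc) t c where "t < h" "ys ! (B + t) < X" "l = xs ! (A + t)" "1 \<le> c" "c < C" "u = xs ! latest c"
    | (ww) s t where "s < h" "ys ! (B + s) < X" "l = xs ! (A + s)" "t < h" "X < ys ! (B + t)" "u = xs ! (A + t)"
    using l u unfolding C_def X_def by blast
  then show ?thesis
  proof cases
    case cc
    obtain i where i: "i < j" "cs ! i = c" "xs ! j < xs ! i"
      using ritmo_coloured_smaller[OF R, of j c] cc by auto
    then show ?thesis using le_latest[of c i] cc by simp
  next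
    case cw
    \<comment> \<open>In the inherited word, an earlier entry above the new one must have a smaller
      colour.\<close>
    have dC: "ds ! (B + t) < C"
    proof (rule ccontr)
      assume "\<not> ds ! (B + t) < C"
      then have "ys ! (B + t) < X"
        using ritmo_coloured_ge[OF R', of "B + h" "B + t"] cw q by (simp add: C_def X_def)
      then show False using cw by simp
    qed
    \<comment> \<open>If \<open>j\<close> precedes the window entry, the colours decide inside
      \<open>xs\<close>; otherwise \<open>j\<close> lies in the window itself and the comparison is
      transferred from \<open>ys\<close>.\<close>
    show ?thesis
    proof (cases "j < A + t")
      case True
      then show ?thesis
        using ritmo_coloured_ge[OF R, of "A + t" j] cw col[of t] dC p by simp
    next
      case False
      define s where "s = j - A"
      have s: "j = A + s" "s < h" using False cw p by (auto simp: s_def)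
      have "ds ! (B + s) = C" using col[of s] s cw by simp
      then have "ys ! (B + s) < X"
        using ritmo_coloured_same[OF R', of "B + h" "B + s"] s q by (simp add: C_def X_def)
      then show ?thesis using ord[of s t] s cw by simp
    qed
  next
    case wc
    \<comment> \<open>\<open>r\<close> blocks colour \<open>c\<close> for the last entry of
      \<open>ys\<close>; it may lie outside the window.\<close>
    obtain r where r: "r < B + h" "ds ! r = c" "X < ys ! r"
      using ritmo_coloured_smaller[OF R', of "B + h" c] wc q by (auto simp: C_def X_def)
    have tc: "latest c < length xs" "cs ! latest c = c" using latest wc by auto
    have in_window: "A + (r - B) \<le> latest c \<and> r - B < h" if "B \<le> r"
      using that r col[of "r - B"] latest_max[of c "A + (r - B)"] wc p by auto
    \<comment> \<open>If the latest entry of colour \<open>c\<close> in \<open>xs\<close> is in the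
      window, its counterpart in \<open>ys\<close> is at least \<open>ys ! r\<close>. Otherwise
      colour \<open>c\<close> is absent from the window, and \<open>r\<close> lies to the left of it
      in \<open>ys\<close>.\<close>
    show ?thesis
    proof (cases "A \<le> latest c")
      case True
      define s where "s = latest c - A"
      have s: "latest c = A + s" "s < h" using True tc p by (auto simp: s_def)
      have dsc: "ds ! (B + s) = c" using col[of s] s tc by simp
      have "ys ! r \<le> ys ! (B + s)"
      proof (cases "r < B + s")
        case True
        then show ?thesis
          using ritmo_coloured_same[OF R', of "B + s" r] r dsc s q by simp
      next
        case False
        then have "r = B + s" using in_window s by auto
        then show ?thesis by simp
      qed
      then have "ys ! (B + t) < ys ! (B + s)" using r wc by simp
      then show ?thesis using ord[of t s] wc s by simp
    next
      case out: False
      then have rB: "r < B" using in_window by (meson le_add1 le_trans linorder_not_le)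
      define d where "d = cs ! (A + t)"
      have d': "ds ! (B + t) = d" using col[of t] wc by (simp add: d_def)
      \<comment> \<open>Otherwise \<open>ys ! r\<close> would be below \<open>ys ! (B + t)\<close>
        and hence below the new value \<open>X\<close>. So the window entry has a colour above
        \<open>c\<close> and carries its own larger entry of colour \<open>c\<close> in
        \<open>xs\<close>.\<close>
      have "c < d"
      proof (rule ccontr)
        assume "\<not> c < d"
        then have "ys ! r < ys ! (B + t)"
          using ritmo_coloured_ge[OF R', of "B + t" r] d' r rB wc q by simp
        then show False using r wc by simp
      qed
      then obtain i where "i < A + t" "cs ! i = c" "xs ! (A + t) < xs ! i"
        using ritmo_coloured_smaller[OF R, of "A + t" c] wc p by (auto simp: d_def)
      then show ?thesis using le_latest[of c i] wc p by simp
    qed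
  next
    case ww
    then have "ys ! (B + s) < ys ! (B + t)" by simp
    then show ?thesis using ord[of s t] ww by simp
  qed
qed

lemma ritmo_coloured_snoc:
  assumes R: "ritmo_coloured xs cs" and C: "1 \<le> C"
    and same: "\<And>j. j < length xs \<Longrightarrow> cs ! j = C \<Longrightarrow> xs ! j < v"
    and smaller: "\<And>c. 1 \<le> c \<Longrightarrow> c < C \<Longrightarrow> \<exists>j<length xs. cs ! j = c \<and> v < xs ! j"
  shows "ritmo_coloured (xs @ [v]) (cs @ [C])"
proof -
  have len: "length cs = length xs" using R by (simp add: ritmo_coloured_def)
  have "1 \<le> (cs @ [C]) ! i \<and>
      (\<forall>j<i. (cs @ [C]) ! j = (cs @ [C]) ! i \<longrightarrow> (xs @ [v]) ! j < (xs @ [v]) ! i) \<and>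
      (\<forall>c. 1 \<le> c \<longrightarrow> c < (cs @ [C]) ! i \<longrightarrow>
        (\<exists>j<i. (cs @ [C]) ! j = c \<and> (xs @ [v]) ! i < (xs @ [v]) ! j))"
    if "i < length (xs @ [v])" for i
  proof (cases "i = length xs")
    case True
    have "\<exists>j<length xs. (cs @ [C]) ! j = c \<and> v < (xs @ [v]) ! j" if c: "1 \<le> c" "c < C" for c
    proof -
      obtain j where "j < length xs" "cs ! j = c" "v < xs ! j" using smaller[OF c] by blast
      then show ?thesis by (intro exI[of _ j]) (simp add: nth_append len)
    qed
    then show ?thesis using True C same by (simp add: nth_append len)
  next
    case False
    then have i: "i < length xs" using that by simp
    have "\<exists>j<i. (cs @ [C]) ! j = c \<and> xs ! i < (xs @ [v]) ! j" if c: "1 \<le> c" "c < cs ! i" for c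
    proof -
      obtain j where "j < i" "cs ! j = c" "xs ! i < xs ! j"
        using ritmo_coloured_smaller[OF R i c] by blast
      then show ?thesis using i by (intro exI[of _ j]) (simp add: nth_append len)
    qed
    then show ?thesis
      using i ritmo_coloured_pos[OF R i] ritmo_coloured_same[OF R i]
      by (simp add: nth_append len)
  qed
  then show ?thesis unfolding ritmo_coloured_def using len by simp
qed

text \<open>The colour of the new entry is copied from the last entry of a word \<open>ys\<close>
  that witnesses \<open>e\<close>; \<open>extension_cut\<close> then leaves a gap for a value
  compatible with both the colours and the window.\<close>

lemma extend_ritmo_word:
  assumes w: "ritmo_word n xs cs" and all: "{1..<n} \<subseteq> set cs" and h: "h \<le> length xs"
    and e: "e \<in> Cinh n (Suc h)" and match: "window h (length xs - h) xs cs = be h e"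
    and n: "1 \<le> n"
  shows "\<exists>v C. ritmo_word n (map (\<lambda>x. 2 * x + 1) xs @ [v]) (cs @ [C]) \<and>
    window (Suc h) (length xs - h) (map (\<lambda>x. 2 * x + 1) xs @ [v]) (cs @ [C]) = e"
proof -
  obtain ys ds where y: "ritmo_word n ys ds" "Suc h \<le> length ys"
      "e = window (Suc h) (length ys - Suc h) ys ds"
    using CinhE[OF e n] by blast
  define A where "A = length xs - h"
  define B where "B = length ys - Suc h"
  have p: "length xs = A + h" and q: "length ys = Suc (B + h)" using h y by (auto simp: A_def B_def)
  have dx: "distinct xs" and dy: "distinct ys"
    and R: "ritmo_coloured xs cs" and R': "ritmo_coloured ys ds"
    and sc: "set cs \<subseteq> {..<n}" and sd: "set ds \<subseteq> {..<n}"
    using w y by (auto simp: ritmo_word_def)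
  have pc: "length cs = A + h" and qc: "length ds = Suc (B + h)"
    using ritmo_word_length[OF w] ritmo_word_length[OF y(1)] p q by auto
  have "window h A xs cs = window h B ys ds"
    using match y be_window[OF dy, of h "Suc h"] by (simp add: A_def B_def)
  then have iso: "order_iso (take h (drop A xs)) (take h (drop B ys))"
    and cols: "take h (drop A cs) = take h (drop B ds)"
    using std_eq_iff[of "take h (drop A xs)"] dx by (auto simp: window_def)
  have ord: "xs ! (A + s) < xs ! (A + t) \<longleftrightarrow> ys ! (B + s) < ys ! (B + t)" if "s < h" "t < h" for s t
    using iso that p q by (auto simp: order_iso_def)
  have col: "cs ! (A + t) = ds ! (B + t)" if "t < h" for t
    using arg_cong[OF cols, of "\<lambda>l. l ! t"] that pc qc by simp
  define C where "C = ds ! (B + h)"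
  define X where "X = ys ! (B + h)"
  have "C \<in> set ds" unfolding C_def using qc by simp
  then have C: "1 \<le> C" "C < n"
    using ritmo_coloured_pos[OF R', of "B + h"] q sd by (auto simp: C_def)
  define latest where "latest c = Max {j. j < length xs \<and> cs ! j = c}" for c
  have latest: "latest c < length xs \<and> cs ! latest c = c" if "1 \<le> c" "c < C" for c
  proof -
    \<comment> \<open>The occurrence of all colours enters here: every smaller colour needs a latest
      entry that can be placed above the new one.\<close>
    have "c \<in> set cs" using all that C by auto
    then have "{j. j < length xs \<and> cs ! j = c} \<noteq> {}"
      using p pc by (auto simp: in_set_conv_nth)
    then have "latest c \<in> {j. j < length xs \<and> cs ! j = c}"
      unfolding latest_def by (intro Max_in) auto
    then show ?thesis by simp
  qed
  have latest_max: "j \<le> latest c" if "j < length xs" "cs ! j = c" for j c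
    unfolding latest_def using that by (intro Max_ge) auto
  define L where "L = {xs ! j | j. j < length xs \<and> cs ! j = C} \<union> {xs ! (A + t) | t. t < h \<and> ys ! (B + t) < X}"
  define H where "H = {xs ! latest c | c. 1 \<le> c \<and> c < C} \<union> {xs ! (A + t) | t. t < h \<and> X < ys ! (B + t)}"
  have "L \<subseteq> set xs" unfolding L_def using p by auto
  then have "finite L" using finite_subset by blast
  moreover have "l < u" if "l \<in> L" "u \<in> H" for l u
    using extension_cut[OF R R' p q ord col, of latest l u] latest latest_max that
    unfolding L_def H_def C_def X_def by blast
  ultimately obtain v where v: "even v" "\<And>l. l \<in> L \<Longrightarrow> 2 * l + 1 < v" "\<And>u. u \<in> H \<Longrightarrow> v < 2 * u + 1"
    using exists_between_doubled[of L H] by blast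
  let ?f = "\<lambda>x::nat. 2 * x + 1"
  let ?xs = "map ?f xs @ [v]"
  let ?cs = "cs @ [C]"
  have odd_v: "v \<noteq> 2 * x + 1" for x using v(1) by auto
  have iso_xs: "order_iso (map ?f xs) xs" by (rule order_iso_map) simp
  have "ritmo_coloured ?xs ?cs"
  proof (rule ritmo_coloured_snoc)
    show "ritmo_coloured (map ?f xs) cs"
      by (rule ritmo_coloured_order_iso[OF order_iso_sym[OF iso_xs] R])
    show "map ?f xs ! j < v" if "j < length (map ?f xs)" "cs ! j = C" for j
      using v(2)[of "xs ! j"] that by (auto simp: L_def)
    show "\<exists>j<length (map ?f xs). cs ! j = c \<and> v < map ?f xs ! j" if c: "1 \<le> c" "c < C" for c
    proof (intro exI[of _ "latest c"] conjI)
      have "xs ! latest c \<in> H" unfolding H_def using c by blast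
      then show "v < map ?f xs ! latest c" using v(3) latest[OF c] by simp
      show "latest c < length (map ?f xs)" "cs ! latest c = c" using latest[OF c] by auto
    qed
  qed (use C in simp)
  moreover have "distinct ?xs"
    using dx odd_v by (auto simp: distinct_map inj_on_def)
  ultimately have "ritmo_word n ?xs ?cs" using sc C by (simp add: ritmo_word_def)
  moreover have "window (Suc h) A ?xs ?cs = e"
  proof -
    have tx: "take (Suc h) (drop A ?xs) = map ?f (take h (drop A xs)) @ [v]"
      using p by (simp add: take_map drop_map)
    have ty: "take (Suc h) (drop B ys) = take h (drop B ys) @ [X]"
      using q take_Suc_conv_app_nth[of h "drop B ys"] by (simp add: X_def)
    have "order_iso (map ?f (take h (drop A xs)) @ [v]) (take h (drop B ys) @ [X])"
    proof (rule order_iso_snoc)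
      show "order_iso (map ?f (take h (drop A xs))) (take h (drop B ys))"
        using iso p q by (simp add: order_iso_def)
      fix i assume "i < length (map ?f (take h (drop A xs)))"
      then have i: "i < h" using p by simp
      then have nx: "map ?f (take h (drop A xs)) ! i = 2 * xs ! (A + i) + 1"
        and ny: "take h (drop B ys) ! i = ys ! (B + i)" using p q by auto
      have "ys ! (B + i) \<noteq> X" unfolding X_def using dy i q by (simp add: nth_eq_iff_index_eq)
      then consider "ys ! (B + i) < X" "xs ! (A + i) \<in> L" | "X < ys ! (B + i)" "xs ! (A + i) \<in> H"
        using i unfolding L_def H_def by fastforce
      then have "(2 * xs ! (A + i) + 1 < v \<longleftrightarrow> ys ! (B + i) < X) \<and>
         (v < 2 * xs ! (A + i) + 1 \<longleftrightarrow> X < ys ! (B + i))"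
        by cases (use v(2)[of "xs ! (A + i)"] v(3)[of "xs ! (A + i)"] in auto)
      then show "(map ?f (take h (drop A xs)) ! i < v) = (take h (drop B ys) ! i < X)"
        "(v < map ?f (take h (drop A xs)) ! i) = (X < take h (drop B ys) ! i)"
        unfolding nx ny by auto
    qed
    from order_iso_sym[OF this] have "std (take (Suc h) (drop B ys)) = std (take (Suc h) (drop A ?xs))"
      unfolding tx ty using distinct_take[OF distinct_drop[OF dy], of "Suc h" B] ty
      by (intro std_eq_if_order_iso) auto
    moreover have "take (Suc h) (drop A ?cs) = take (Suc h) (drop B ds)"
      using cols pc qc take_Suc_conv_app_nth[of h "drop B ds"] by (simp add: C_def)
    ultimately show ?thesis using y(3) by (simp add: window_def B_def)
  qed
  ultimately show ?thesis unfolding A_def by blast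
qed

section \<open>Realising walks in the coloured overlap graph\<close>

lemma window_append:
  assumes "i + k \<le> length xs" "length cs = length xs"
  shows "window k i (xs @ ys) (cs @ ds) = window k i xs cs"
  using assms by (simp add: window_def)

lemma window_map:
  assumes "\<And>x y. x < y \<Longrightarrow> f x < f y" "distinct xs"
  shows "window k i (map f xs) cs = window k i xs cs"
proof -
  have "order_iso (take k (drop i (map f xs))) (take k (drop i xs))"
    by (intro order_iso_take order_iso_drop order_iso_map assms(1))
  from std_eq_if_order_iso[OF order_iso_sym[OF this]] show ?thesis
    using assms(2) by (simp add: window_def)
qed

text \<open>Each extension relabels all values, so the induction tracks windows, which depend only
  on relative order. The clause for \<open>es = []\<close> lets the first edge use the starting
  window, where later edges use the end of the preceding edge.\<close>

lemma realise_walk: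
  assumes w: "ritmo_word n xs0 cs0" and all: "{1..<n} \<subseteq> set cs0" and h: "h \<le> length xs0" and n: "1 \<le> n"
  shows "set es \<subseteq> Cinh n (Suc h) \<Longrightarrow>
    (es \<noteq> [] \<Longrightarrow> window h (length xs0 - h) xs0 cs0 = be h (es ! 0)) \<Longrightarrow>
    (\<And>i. Suc i < length es \<Longrightarrow> en h (es ! i) = be h (es ! Suc i)) \<Longrightarrow>
    \<exists>xs cs. ritmo_word n xs cs \<and> {1..<n} \<subseteq> set cs \<and> length xs = length xs0 + length es \<and>
      (es = [] \<longrightarrow> xs = xs0 \<and> cs = cs0) \<and>
      (\<forall>i<length es. window (Suc h) (length xs0 - h + i) xs cs = es ! i)"
proof (induction es rule: rev_induct)
  case Nil
  then show ?case using w all by (intro exI[of _ xs0] exI[of _ cs0]) simp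
next
  case (snoc e es)
  have "\<exists>xs cs. ritmo_word n xs cs \<and> {1..<n} \<subseteq> set cs \<and> length xs = length xs0 + length es \<and>
      (es = [] \<longrightarrow> xs = xs0 \<and> cs = cs0) \<and>
      (\<forall>i<length es. window (Suc h) (length xs0 - h + i) xs cs = es ! i)"
  proof (rule snoc.IH)
    show "set es \<subseteq> Cinh n (Suc h)" using snoc.prems(1) by simp
    show "window h (length xs0 - h) xs0 cs0 = be h (es ! 0)" if "es \<noteq> []"
      using snoc.prems(2) that by (simp add: nth_append)
    show "en h (es ! i) = be h (es ! Suc i)" if "Suc i < length es" for i
      using snoc.prems(3)[of i] that by (simp add: nth_append)
  qed
  then obtain xs cs where x: "ritmo_word n xs cs" "{1..<n} \<subseteq> set cs"
      "length xs = length xs0 + length es" "es = [] \<longrightarrow> xs = xs0 \<and> cs = cs0"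
      "\<And>i. i < length es \<Longrightarrow> window (Suc h) (length xs0 - h + i) xs cs = es ! i" by blast
  have len: "length cs = length xs" and d: "distinct xs"
    using x(1) by (auto simp: ritmo_word_length ritmo_word_def)
  have match: "window h (length xs - h) xs cs = be h e"
  proof (cases "es = []")
    case True
    then show ?thesis using snoc.prems(2) x by simp
  next
    case False
    then obtain m where m: "length es = Suc m" by (cases es) auto
    have "window h (length xs - h) xs cs = en h (window (Suc h) (length xs0 - h + m) xs cs)"
      using m h x(3) by (subst en_window[OF d len]) (auto simp: algebra_simps)
    also have "\<dots> = en h (es ! m)" using x(5) m by simp
    also have "\<dots> = be h e" using snoc.prems(3)[of m] m by (simp add: nth_append)
    finally show ?thesis .
  qed
  have hx: "h \<le> length xs" using h x(3) by simp
  have e: "e \<in> Cinh n (Suc h)" using snoc.prems(1) by simp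
  obtain v C where v: "ritmo_word n (map (\<lambda>x. 2 * x + 1) xs @ [v]) (cs @ [C])"
    "window (Suc h) (length xs - h) (map (\<lambda>x. 2 * x + 1) xs @ [v]) (cs @ [C]) = e"
    using extend_ritmo_word[OF x(1,2) hx e match n] by blast
  have "window (Suc h) (length xs0 - h + i) (map (\<lambda>x. 2 * x + 1) xs @ [v]) (cs @ [C]) = (es @ [e]) ! i"
    if "i < length (es @ [e])" for i
  proof (cases "i = length es")
    case True
    then show ?thesis using v(2) x(3) h by simp
  next
    case False
    then have i: "i < length es" using that by simp
    have "window (Suc h) (length xs0 - h + i) (map (\<lambda>x. 2 * x + 1) xs @ [v]) (cs @ [C]) =
        window (Suc h) (length xs0 - h + i) (map (\<lambda>x. 2 * x + 1) xs) cs"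
      using i x(3) h len by (intro window_append) auto
    also have "\<dots> = window (Suc h) (length xs0 - h + i) xs cs"
      using d by (intro window_map) auto
    finally show ?thesis using x(5)[OF i] i by (simp add: nth_append)
  qed
  moreover have "{1..<n} \<subseteq> set (cs @ [C])" using x(2) by auto
  moreover have "length (map (\<lambda>x. 2 * x + 1) xs @ [v]) = length xs0 + length (es @ [e])" using x(3) by simp
  ultimately show ?case using v(1)
    by (intro exI[of _ "map (\<lambda>x. 2 * x + 1) xs @ [v]"] exI[of _ "cs @ [C]"]) simp
qed

section \<open>Direct sums of coloured words\<close>

text \<open>The shift exceeds every entry of \<open>xs\<close> and, unlike a maximum, also makes
  sense for the empty list.\<close>

definition dsum :: "nat list \<Rightarrow> nat list \<Rightarrow> nat list" where
  "dsum xs ys = xs @ map (\<lambda>y. Suc (sum_list xs) + y) ys"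

lemma length_dsum [simp]: "length (dsum xs ys) = length xs + length ys"
  by (simp add: dsum_def)

lemma dsum_nth_left: "i < length xs \<Longrightarrow> dsum xs ys ! i = xs ! i"
  by (simp add: dsum_def nth_append)

lemma dsum_nth_right: "j < length ys \<Longrightarrow> dsum xs ys ! (length xs + j) = Suc (sum_list xs) + ys ! j"
  by (simp add: dsum_def nth_append)

lemma dsum_left_less_right:
  "i < length xs \<Longrightarrow> j < length ys \<Longrightarrow> dsum xs ys ! i < dsum xs ys ! (length xs + j)"
  using member_le_sum_list[of "xs ! i" xs] by (simp add: dsum_nth_left dsum_nth_right)

text \<open>Entries of the upper block exceed the whole lower block, so the lower block cannot
  violate the growth of a colour class; the larger entries of smaller colours are found inside each
  block as before.\<close>

lemma ritmo_word_dsum: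
  assumes x: "ritmo_word n xs cs" and y: "ritmo_word n ys ds"
  shows "ritmo_word n (dsum xs ys) (cs @ ds)"
proof -
  have R: "ritmo_coloured xs cs" and R': "ritmo_coloured ys ds"
    and dx: "distinct xs" and dy: "distinct ys"
    using x y by (auto simp: ritmo_word_def)
  have len: "length cs = length xs" "length ds = length ys"
    using R R' by (auto simp: ritmo_coloured_def)
  have col: "(cs @ ds) ! (length xs + j) = ds ! j" for j using len nth_append_length_plus[of cs ds j] by simp
  have "ritmo_coloured (dsum xs ys) (cs @ ds)"
    unfolding ritmo_coloured_def
  proof (intro conjI allI impI)
    show "length (cs @ ds) = length (dsum xs ys)" using len by simp
    fix i assume "i < length (dsum xs ys)"
    then consider "i < length xs" | t where "i = length xs + t" "t < length ys"
      by (metis add_diff_inverse_nat add_less_cancel_left length_dsum)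
    note i_cases = this
    show "1 \<le> (cs @ ds) ! i"
      using i_cases ritmo_coloured_pos[OF R] ritmo_coloured_pos[OF R']
      by cases (auto simp: nth_append len)
    show "dsum xs ys ! j < dsum xs ys ! i" if j: "j < i" "(cs @ ds) ! j = (cs @ ds) ! i" for j
      using i_cases
    proof cases
      case 1
      then show ?thesis using ritmo_coloured_same[OF R 1 j(1)] j by (simp add: dsum_nth_left nth_append len)
    next
      case (2 t)
      show ?thesis
      proof (cases "j < length xs")
        case True
        then show ?thesis using dsum_left_less_right[of j xs t ys] 2 by simp
      next
        case False
        define s where "s = j - length xs"
        have s: "j = length xs + s" "s < t" using False 2 j by (auto simp: s_def)
        then have "ys ! s < ys ! t" using ritmo_coloured_same[OF R' 2(2), of s] j 2 col by simp
        then show ?thesis using s 2 by (simp add: dsum_nth_right)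
      qed
    qed
    show "\<exists>j<i. (cs @ ds) ! j = c \<and> dsum xs ys ! i < dsum xs ys ! j" if c: "1 \<le> c" "c < (cs @ ds) ! i" for c
      using i_cases
    proof cases
      case 1
      then obtain j where "j < i" "cs ! j = c" "xs ! i < xs ! j"
        using ritmo_coloured_smaller[OF R 1 c(1)] c by (auto simp: nth_append len)
      then show ?thesis using 1 by (intro exI[of _ j]) (simp add: dsum_nth_left nth_append len)
    next
      case (2 t)
      then obtain s where "s < t" "ds ! s = c" "ys ! t < ys ! s"
        using ritmo_coloured_smaller[OF R' 2(2) c(1)] c col by auto
      then show ?thesis using 2 col by (intro exI[of _ "length xs + s"]) (simp add: dsum_nth_right)
    qed
  qed
  moreover have "distinct (dsum xs ys)"
  proof -
    have "x \<le> sum_list xs" if "x \<in> set xs" for x using member_le_sum_list[OF that] by simp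
    then show ?thesis using dx dy by (fastforce simp: dsum_def distinct_map inj_on_def)
  qed
  ultimately show ?thesis using x y by (auto simp: ritmo_word_def)
qed

lemma window_dsum_right:
  assumes "length cs = length xs" "distinct ys"
  shows "window k (length xs + i) (dsum xs ys) (cs @ ds) = window k i ys ds"
proof -
  have "window k (length xs + i) (dsum xs ys) (cs @ ds) = window k i (map (\<lambda>y. Suc (sum_list xs) + y) ys) ds"
    using assms by (simp add: window_def dsum_def)
  also have "\<dots> = window k i ys ds" using assms(2) by (intro window_map) auto
  finally show ?thesis .
qed

text \<open>Prepending this word makes all colours occur without changing the final window.\<close>
lemma ritmo_word_dec:
  assumes "1 \<le> n"
  shows "ritmo_word n (dec (n - 1)) [1..<n]"
proof -
  have "ritmo_coloured (dec (n - 1)) [1..<n]"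
    unfolding ritmo_coloured_def
  proof (intro conjI allI impI)
    fix i assume i: "i < length (dec (n - 1))"
    show "1 \<le> [1..<n] ! i" using i by simp
    show "dec (n - 1) ! j < dec (n - 1) ! i" if "j < i" "[1..<n] ! j = [1..<n] ! i" for j
      using that i by simp
    show "\<exists>j<i. [1..<n] ! j = c \<and> dec (n - 1) ! i < dec (n - 1) ! j" if "1 \<le> c" "c < [1..<n] ! i" for c
      using that i by (intro exI[of _ "c - 1"]) (auto simp: dec_nth)
  qed simp
  then show ?thesis using perm_of_dec[of "n - 1"] by (auto simp: ritmo_word_def perm_of_def)
qed

text \<open>This provides the starting word for \<open>realise_walk\<close> at a given vertex: the
  decreasing block supplies the colours, an inherited word above it the final window.\<close>

lemma realise_start:
  assumes "u \<in> Cinh n h" "1 \<le> n"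
  obtains xs cs where "ritmo_word n xs cs" "{1..<n} \<subseteq> set cs" "h \<le> length xs"
    "window h (length xs - h) xs cs = u"
proof -
  obtain ys ds where y: "ritmo_word n ys ds" "h \<le> length ys" "u = window h (length ys - h) ys ds"
    using CinhE[OF assms] by blast
  have "window h (length (dec (n - 1)) + (length ys - h)) (dsum (dec (n - 1)) ys) ([1..<n] @ ds) = u"
    unfolding y(3) by (rule window_dsum_right) (use y in \<open>auto simp: ritmo_word_def\<close>)
  then show ?thesis
    using that[of "dsum (dec (n - 1)) ys" "[1..<n] @ ds"] ritmo_word_dsum[OF ritmo_word_dec[OF assms(2)] y(1)] y(2)
    by auto
qed

section \<open>Counting pattern occurrences\<close>

definition occ :: "nat \<Rightarrow> nat list \<Rightarrow> nat list \<Rightarrow> nat" where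
  "occ k \<pi> xs = card {i. i + k \<le> length xs \<and> std (take k (drop i xs)) = \<pi>}"

lemma cocc_eq_occ: "length \<pi> = k \<Longrightarrow> cocc \<pi> xs = real (occ k \<pi> xs) / real (length xs)"
  by (simp add: cocc_def occ_def pat_def nths_interval)

lemma occ_std:
  assumes "distinct xs"
  shows "occ k \<pi> (std xs) = occ k \<pi> xs"
proof -
  have "std (take k (drop i (std xs))) = std (take k (drop i xs))" for i
    using window_std[OF assms, of k i "[]"] by (simp add: window_def)
  then show ?thesis by (simp add: occ_def)
qed

text \<open>Windows inside a block keep their patterns. Only windows crossing the junction are
  uncontrolled, and these start among the last \<open>k\<close> positions of
  \<open>xs\<close>.\<close>

lemma occ_dsum:
  assumes "distinct ys" "1 \<le> k"
  shows "occ k \<pi> xs + occ k \<pi> ys \<le> occ k \<pi> (dsum xs ys)"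
    and "occ k \<pi> (dsum xs ys) \<le> occ k \<pi> xs + occ k \<pi> ys + k"
proof -
  define P where "P zs = {i. i + k \<le> length zs \<and> std (take k (drop i zs)) = \<pi>}" for zs
  have fin: "finite (P zs)" for zs
    by (rule finite_subset[of _ "{..length zs}"]) (auto simp: P_def)
  have left: "std (take k (drop i (dsum xs ys))) = std (take k (drop i xs))" if "i + k \<le> length xs" for i
    using that by (simp add: dsum_def)
  \<comment> \<open>The colour lists are dummies: \<open>xs\<close> serves as one because only its
    length enters.\<close>
  have right: "std (take k (drop (length xs + i) (dsum xs ys))) = std (take k (drop i ys))" for i
    using window_dsum_right[of xs xs ys k i "[]"] assms(1) by (simp add: window_def)
  let ?S = "(+) (length xs) ` P ys"
  have cS: "card ?S = card (P ys)" by (simp add: card_image)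
  have "P xs \<union> ?S \<subseteq> P (dsum xs ys)" using left right by (auto simp: P_def)
  then have "card (P xs \<union> ?S) \<le> card (P (dsum xs ys))" by (intro card_mono fin)
  \<comment> \<open>For windows of length 0 the position \<open>length xs\<close> would be counted
    in both blocks.\<close>
  moreover have "P xs \<inter> ?S = {}" using assms(2) by (auto simp: P_def)
  ultimately show "occ k \<pi> xs + occ k \<pi> ys \<le> occ k \<pi> (dsum xs ys)"
    using fin cS by (simp add: card_Un_disjoint occ_def P_def)
  have "P (dsum xs ys) \<subseteq> P xs \<union> ?S \<union> {length xs - k..<length xs}"
  proof
    fix i assume i: "i \<in> P (dsum xs ys)"
    consider "i + k \<le> length xs" | "length xs - k \<le> i" "i < length xs" | s where "i = length xs + s"
      by (metis le_add_diff_inverse le_diff_conv linorder_not_le nat_le_linear)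
    then show "i \<in> P xs \<union> ?S \<union> {length xs - k..<length xs}"
    proof cases
      case 1
      then show ?thesis using i left[OF 1] by (simp add: P_def)
    next
      case 2
      then show ?thesis by simp
    next
      case (3 s)
      then show ?thesis using i right[of s] by (auto simp: P_def)
    qed
  qed
  then have "card (P (dsum xs ys)) \<le> card (P xs \<union> ?S \<union> {length xs - k..<length xs})"
    by (intro card_mono) (use fin in auto)
  also have "\<dots> \<le> card (P xs) + card (P ys) + k"
    using card_Un_le[of "P xs \<union> ?S" "{length xs - k..<length xs}"] card_Un_le[of "P xs" ?S] cS by simp
  finally show "occ k \<pi> (dsum xs ys) \<le> occ k \<pi> xs + occ k \<pi> ys + k"
    by (simp add: occ_def P_def)
qed

section \<open>Circulations\<close>

definition cyclic_walk :: "('e \<Rightarrow> 'v) \<Rightarrow> ('e \<Rightarrow> 'v) \<Rightarrow> 'e list \<Rightarrow> bool" where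
  "cyclic_walk src tgt es \<longleftrightarrow>
     (\<forall>i < length es. tgt (es ! i) = src (es ! ((i + 1) mod length es)))"

text \<open>As a consequence, every vertex is entered as often as it is left.\<close>

lemma cyclic_walk_map_tgt:
  assumes "cyclic_walk src tgt es"
  shows "map tgt es = rotate1 (map src es)"
proof (rule nth_equalityI)
  fix i assume "i < length (map tgt es)"
  moreover from this have "Suc i mod length es < length es" by (intro mod_less_divisor) auto
  ultimately show "map tgt es ! i = rotate1 (map src es) ! i"
    using assms by (simp add: cyclic_walk_def nth_rotate1)
qed simp

lemma sum_count_list:
  assumes "finite E" "set es \<subseteq> E"
  shows "(\<Sum>e\<in>{e\<in>E. f e = u}. count_list es e) = count_list (map f es) u"
  using assms(2)
proof (induction es)
  case (Cons a es)
  have "(\<Sum>e\<in>{e\<in>E. f e = u}. count_list (a # es) e) =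
      (\<Sum>e\<in>{e\<in>E. f e = u}. (if e = a then 1 else 0) + count_list es e)"
    by (intro sum.cong) auto
  also have "\<dots> = (if f a = u then 1 else 0) + count_list (map f es) u"
    using Cons assms(1) by (simp add: sum.distrib)
  finally show ?case by simp
qed simp

lemma sum_cycle_count:
  assumes "finite E" "set es \<subseteq> E" "cyclic_walk src tgt es"
  shows "(\<Sum>e\<in>{e\<in>E. src e = u}. count_list es e) = (\<Sum>e\<in>{e\<in>E. tgt e = u}. count_list es e)"
proof -
  have "count_list (rotate1 xs) u = count_list xs u" for xs :: "'b list"
    by (cases xs) auto
  then show ?thesis
    by (simp add: sum_count_list[OF assms(1,2)] cyclic_walk_map_tgt[OF assms(3)])
qed

text \<open>Following chosen successors in a finite set must revisit a vertex. Taking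
  \<open>j\<close> as the first time this happens makes the sources from \<open>i\<close> up to
  \<open>j - 1\<close> distinct.\<close>

lemma exists_simple_cycle:
  assumes fin: "finite S" and ne: "e0 \<in> S"
    and step: "\<And>e. e \<in> S \<Longrightarrow> \<exists>e'\<in>S. src e' = tgt e"
  shows "\<exists>es. es \<noteq> [] \<and> set es \<subseteq> S \<and> cyclic_walk src tgt es \<and> distinct (map src es)"
proof -
  obtain nxt where nxt: "\<And>e. e \<in> S \<Longrightarrow> nxt e \<in> S \<and> src (nxt e) = tgt e"
    using step by metis
  define f where "f i = (nxt ^^ i) e0" for i
  have fS: "f i \<in> S" for i by (induction i) (auto simp: f_def ne nxt)
  have fstep: "src (f (Suc i)) = tgt (f i)" for i
    using nxt[OF fS[of i]] by (simp add: f_def)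
  have "\<exists>j. \<exists>i<j. src (f i) = src (f j)"
  proof (rule ccontr)
    assume "\<not> ?thesis"
    then have "inj (\<lambda>i. src (f i))" by (metis injI linorder_neqE_nat)
    moreover have "finite (range (\<lambda>i. src (f i)))"
      by (rule finite_subset[of _ "src ` S"]) (use fS fin in auto)
    ultimately show False using finite_imageD infinite_UNIV_nat by blast
  qed
  define j where "j = (LEAST j. \<exists>i<j. src (f i) = src (f j))"
  have "\<exists>i<j. src (f i) = src (f j)"
    unfolding j_def by (rule LeastI_ex) fact
  then obtain i where i: "i < j" "src (f i) = src (f j)" by blast
  have min: "src (f a) \<noteq> src (f b)" if "a < b" "b < j" for a b
    using not_less_Least[of b "\<lambda>j. \<exists>i<j. src (f i) = src (f j)"] that by (auto simp: j_def)
  define es where "es = map f [i..<j]"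
  have len: "length es = j - i" by (simp add: es_def)
  have nth: "es ! t = f (i + t)" if "t < j - i" for t using that by (simp add: es_def)
  have "cyclic_walk src tgt es"
    unfolding cyclic_walk_def
  proof (intro allI impI)
    fix t assume t: "t < length es"
    show "tgt (es ! t) = src (es ! ((t + 1) mod length es))"
    proof (cases "t + 1 = length es")
      case True
      then have "i + Suc t = j" using len i by simp
      then show ?thesis using True nth[of t] nth[of 0] t len i fstep[of "i + t"] by auto
    next
      case False
      then show ?thesis using nth[of t] nth[of "Suc t"] t len fstep[of "i + t"] by auto
    qed
  qed
  moreover have "distinct (map src es)"
    unfolding es_def distinct_map map_map inj_on_def comp_def
    using min by (auto simp: distinct_conv_nth nth_eq_iff_index_eq) (metis linorder_neqE_nat min)+
  ultimately show ?thesis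
    using i fS by (intro exI[of _ es]) (auto simp: es_def)
qed

text \<open>Weights are not normalised, so the class fits an induction that peels off cycles; mass 1
  is restored in \<open>circulation_in_cycle_polytope\<close>.\<close>

definition conic_hull :: "('e \<Rightarrow> real) set \<Rightarrow> ('e \<Rightarrow> real) set" where
  "conic_hull S = {w. \<exists>X \<mu>. finite X \<and> X \<subseteq> S \<and> (\<forall>x\<in>X. 0 \<le> \<mu> x) \<and>
     w = (\<lambda>e. \<Sum>x\<in>X. \<mu> x * x e)}"

lemma conic_hull_add:
  assumes "w \<in> conic_hull S" "y \<in> S" "0 \<le> a"
  shows "(\<lambda>e. w e + a * y e) \<in> conic_hull S"
proof -
  obtain X \<mu> where X: "finite X" "X \<subseteq> S" "\<forall>x\<in>X. 0 \<le> \<mu> x" "w = (\<lambda>e. \<Sum>x\<in>X. \<mu> x * x e)"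
    using assms by (auto simp: conic_hull_def)
  \<comment> \<open>\<open>y\<close> may already belong to \<open>X\<close>, in which case its two
    weights add up.\<close>
  define \<nu> where "\<nu> x = (if x \<in> X then \<mu> x else 0) + (if x = y then a else 0)" for x
  have "(\<Sum>x\<in>insert y X. \<nu> x * x e) = w e + a * y e" for e
  proof -
    have "(\<Sum>x\<in>insert y X. \<nu> x * x e) =
        (\<Sum>x\<in>insert y X. if x \<in> X then \<mu> x * x e else 0) + (\<Sum>x\<in>insert y X. if x = y then a * x e else 0)"
      unfolding sum.distrib[symmetric] by (intro sum.cong) (auto simp: \<nu>_def algebra_simps)
    also have "(\<Sum>x\<in>insert y X. if x \<in> X then \<mu> x * x e else 0) = w e"
    proof -
      have "insert y X \<inter> {x. x \<in> X} = X" by auto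
      then show ?thesis using X by (simp add: sum.If_cases)
    qed
    also have "(\<Sum>x\<in>insert y X. if x = y then a * x e else 0) = a * y e"
      using X by simp
    finally show ?thesis .
  qed
  then show ?thesis using X assms unfolding conic_hull_def
    by (intro CollectI exI[of _ "insert y X"] exI[of _ \<nu>]) (auto simp: \<nu>_def)
qed

text \<open>Subtracting the least weight along a cycle inside the support preserves balance and
  nonnegativity and removes at least one edge from the support, whose size drives the
  induction.\<close>

lemma circulation_in_conic_hull:
  fixes w :: "'e \<Rightarrow> real"
  assumes fin: "finite E"
    and "\<And>e. 0 \<le> w e" "\<And>e. e \<notin> E \<Longrightarrow> w e = 0"
    and "\<And>u. (\<Sum>e\<in>{e\<in>E. src e = u}. w e) = (\<Sum>e\<in>{e\<in>E. tgt e = u}. w e)"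
  shows "w \<in> conic_hull ((\<lambda>es e. real (count_list es e) / real (length es)) ` {es. es \<noteq> [] \<and> set es \<subseteq> E \<and> cyclic_walk src tgt es \<and>
     distinct (map src es)})" (is "_ \<in> conic_hull ?S")
  using assms(2-4)
proof (induction "card {e. w e \<noteq> 0}" arbitrary: w rule: less_induct)
  case less
  note nonneg = less.prems(1) and supp = less.prems(2) and bal = less.prems(3)
  define T where "T = {e. w e \<noteq> 0}"
  have TE: "T \<subseteq> E" using supp by (auto simp: T_def)
  then have finT: "finite T" using fin finite_subset by blast
  show ?case
  proof (cases "T = {}")
    case True
    then have "w = (\<lambda>e. 0)" by (auto simp: T_def)
    then show ?thesis unfolding conic_hull_def by (intro CollectI exI[of _ "{}"]) auto
  next
    case False
    then obtain e0 where e0: "e0 \<in> T" by blast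
    \<comment> \<open>The support has no dead ends: if none of its edges left the target of
      \<open>e\<close>, balance would make the inflow there vanish, and with it
      \<open>w e\<close>.\<close>
    have "\<exists>e'\<in>T. src e' = tgt e" if e: "e \<in> T" for e
    proof (rule ccontr)
      assume "\<not> ?thesis"
      then have "(\<Sum>e'\<in>{e'\<in>E. src e' = tgt e}. w e') = 0"
        by (intro sum.neutral) (auto simp: T_def)
      then have "(\<Sum>e'\<in>{e'\<in>E. tgt e' = tgt e}. w e') = 0" using bal by simp
      then have "\<forall>e'\<in>{e'\<in>E. tgt e' = tgt e}. w e' = 0"
        using nonneg fin by (subst (asm) sum_nonneg_eq_0_iff) auto
      then have "w e = 0" using e TE by blast
      then show False using e by (simp add: T_def)
    qed
    from exists_simple_cycle[where src = src and tgt = tgt, OF finT e0 this] obtain es where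
      es: "es \<noteq> []" "set es \<subseteq> T" "cyclic_walk src tgt es" "distinct (map src es)" by blast
    have dist: "distinct es" using es(4) by (simp add: distinct_map)
    define a where "a = Min (w ` set es)"
    have "a \<in> w ` set es" unfolding a_def using es by (intro Min_in) auto
    then obtain e1 where e1: "e1 \<in> set es" "w e1 = a" by auto
    have apos: "0 \<le> a" using e1 nonneg by auto
    have amin: "a \<le> w e" if "e \<in> set es" for e unfolding a_def using that by simp
    define w' where "w' e = w e - a * real (count_list es e)" for e
    have cnt: "count_list es e = (if e \<in> set es then 1 else 0)" for e
      using dist by (induction es) auto
    have esE: "set es \<subseteq> E" using es TE by blast
    have sub: "{e. w' e \<noteq> 0} \<subset> T"
    proof
      show "{e. w' e \<noteq> 0} \<subseteq> T" using es by (auto simp: w'_def cnt T_def split: if_splits)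
      have "e1 \<in> T" "w' e1 = 0" using e1 es by (auto simp: w'_def cnt)
      then show "{e. w' e \<noteq> 0} \<noteq> T" by blast
    qed
    have "w' \<in> conic_hull ?S"
    proof (rule less.hyps)
      show "card {e. w' e \<noteq> 0} < card {e. w e \<noteq> 0}"
        using sub finT psubset_card_mono unfolding T_def by blast
      show "0 \<le> w' e" for e using amin nonneg by (simp add: w'_def cnt)
      show "w' e = 0" if "e \<notin> E" for e using that supp esE by (auto simp: w'_def cnt)
      show "(\<Sum>e\<in>{e \<in> E. src e = u}. w' e) = (\<Sum>e\<in>{e \<in> E. tgt e = u}. w' e)" for u
      proof -
        have "(\<Sum>e\<in>{e \<in> E. src e = u}. real (count_list es e)) =
            (\<Sum>e\<in>{e \<in> E. tgt e = u}. real (count_list es e))"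
          unfolding of_nat_sum[symmetric] using sum_cycle_count[OF fin esE es(3)] by simp
        then show ?thesis using bal
          by (simp add: w'_def sum_subtractf sum_distrib_left[symmetric])
      qed
    qed
    moreover have "(\<lambda>e. real (count_list es e) / real (length es)) \<in> ?S" using es esE by blast
    \<comment> \<open>The factor \<open>length es\<close> undoes the normalisation of the cycle
      vector.\<close>
    ultimately have "(\<lambda>e. w' e + (a * length es) * (real (count_list es e) / real (length es)))
        \<in> conic_hull ?S"
      using apos by (intro conic_hull_add) auto
    also have "(\<lambda>e. w' e + (a * length es) * (real (count_list es e) / real (length es))) = w"
      using es by (auto simp: w'_def)
    finally show ?thesis .
  qed
qed

section \<open>Realising convex combinations of cycles\<close>

text \<open>\<open>K\<close> is uniform in \<open>N\<close> and in the pattern, so the error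
  disappears after division by \<open>N\<close>. Allowing any total weight \<open>t\<close>, not
  only 1, makes the notion additive under direct sums.\<close>

definition realisable :: "nat \<Rightarrow> nat \<Rightarrow> (nat list \<Rightarrow> real) \<Rightarrow> real \<Rightarrow> bool" where
  "realisable n k v t \<longleftrightarrow> (\<exists>K. \<forall>N::nat. \<exists>xs cs. ritmo_word n xs cs \<and>
     \<bar>real (length xs) - real N * t\<bar> \<le> K \<and> (\<forall>\<pi>. \<bar>real (occ k \<pi> xs) - real N * v \<pi>\<bar> \<le> K))"

lemma realisable_zero:
  assumes "1 \<le> k"
  shows "realisable n k (\<lambda>_. 0) 0"
proof -
  have "ritmo_word n [] []" by (simp add: ritmo_word_def ritmo_coloured_def)
  moreover have "occ k \<pi> [] = 0" for \<pi> using assms by (simp add: occ_def)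
  ultimately show ?thesis unfolding realisable_def by (intro exI[of _ 0]) force
qed

text \<open>The two errors add; the extra \<open>k\<close> pays for the windows across the
  junction.\<close>

lemma realisable_add:
  assumes "realisable n k v t" "realisable n k v' t'" "1 \<le> k"
  shows "realisable n k (\<lambda>\<pi>. v \<pi> + v' \<pi>) (t + t')"
proof -
  obtain K where K: "\<And>N::nat. \<exists>xs cs. ritmo_word n xs cs \<and>
     \<bar>real (length xs) - real N * t\<bar> \<le> K \<and> (\<forall>\<pi>. \<bar>real (occ k \<pi> xs) - real N * v \<pi>\<bar> \<le> K)"
    using assms(1) unfolding realisable_def by blast
  obtain K' where K': "\<And>N::nat. \<exists>xs cs. ritmo_word n xs cs \<and>
     \<bar>real (length xs) - real N * t'\<bar> \<le> K' \<and> (\<forall>\<pi>. \<bar>real (occ k \<pi> xs) - real N * v' \<pi>\<bar> \<le> K')"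
    using assms(2) unfolding realisable_def by blast
  show ?thesis unfolding realisable_def
  proof (intro exI[of _ "K + K' + real k"] allI)
    fix N :: nat
    obtain xs cs where x: "ritmo_word n xs cs" "\<bar>real (length xs) - real N * t\<bar> \<le> K"
      "\<And>\<pi>. \<bar>real (occ k \<pi> xs) - real N * v \<pi>\<bar> \<le> K" using K by blast
    obtain ys ds where y: "ritmo_word n ys ds" "\<bar>real (length ys) - real N * t'\<bar> \<le> K'"
      "\<And>\<pi>. \<bar>real (occ k \<pi> ys) - real N * v' \<pi>\<bar> \<le> K'" using K' by blast
    have dy: "distinct ys" using y by (simp add: ritmo_word_def)
    show "\<exists>xs cs. ritmo_word n xs cs \<and> \<bar>real (length xs) - real N * (t + t')\<bar> \<le> K + K' + real k \<and>
      (\<forall>\<pi>. \<bar>real (occ k \<pi> xs) - real N * (v \<pi> + v' \<pi>)\<bar> \<le> K + K' + real k)"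
    proof (rule exI[of _ "dsum xs ys"], rule exI[of _ "cs @ ds"], intro conjI allI)
      show "ritmo_word n (dsum xs ys) (cs @ ds)" using ritmo_word_dsum x y by blast
      show "\<bar>real (length (dsum xs ys)) - real N * (t + t')\<bar> \<le> K + K' + real k"
        using x(2) y(2) by (simp add: distrib_left)
      show "\<bar>real (occ k \<pi> (dsum xs ys)) - real N * (v \<pi> + v' \<pi>)\<bar> \<le> K + K' + real k" for \<pi>
        using x(3)[of \<pi>] y(3)[of \<pi>] occ_dsum[OF dy assms(3), of \<pi> xs] by (simp add: distrib_left)
    qed
  qed
qed

lemma card_mod_periodic:
  fixes L r :: nat
  assumes "0 < L"
  shows "card {t. t < r * L \<and> P (t mod L)} = r * card {t. t < L \<and> P t}"
proof (induction r)
  case (Suc r)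
  have "{t. t < Suc r * L \<and> P (t mod L)} =
      {t. t < r * L \<and> P (t mod L)} \<union> (+) (r * L) ` {t. t < L \<and> P t}" (is "?A = ?B \<union> ?C")
  proof (intro equalityI subsetI)
    fix t assume t: "t \<in> ?A"
    show "t \<in> ?B \<union> ?C"
    proof (cases "t < r * L")
      case False
      define s where "s = t - r * L"
      have s: "t = r * L + s" "s < L" using t False by (auto simp: s_def)
      then have "P s" using t by simp
      then show ?thesis using s by blast
    qed (use t in auto)
  qed auto
  moreover have "?B \<inter> ?C = {}" by auto
  moreover have "finite ?B" "finite ?C" by auto
  ultimately have "card ?A = card ?B + card ?C" by (simp add: card_Un_disjoint)
  moreover have "card ?C = card {t. t < L \<and> P t}" by (simp add: card_image)
  ultimately show ?case using Suc by simp
qed simp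

lemma Pi_forget_cycvec:
  assumes "set es \<subseteq> Cinh n k" "1 \<le> n"
  shows "Pi_forget n k (cycvec es) \<pi> = real (card {t. t < length es \<and> fst (es ! t) = \<pi>}) / real (length es)"
proof -
  have "(\<Sum>e\<in>{e \<in> Cinh n k. fst e = \<pi>}. real (count_list es e)) = real (count_list (map fst es) \<pi>)"
    using arg_cong[OF sum_count_list[OF finite_Cinh[OF assms(2)] assms(1), of fst \<pi>], of real]
    by (simp only: of_nat_sum)
  moreover have "count_list (map fst es) \<pi> = card {t. t < length es \<and> fst (es ! t) = \<pi>}"
  proof -
    have "{t. t < length (map fst es) \<and> \<pi> = map fst es ! t} = {t. t < length es \<and> fst (es ! t) = \<pi>}"
      by auto
    then show ?thesis by (simp only: count_list_eq_length_filter length_filter_conv_card)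
  qed
  ultimately show ?thesis by (simp add: Pi_forget_def cycvec_def sum_divide_distrib[symmetric])
qed

text \<open>About \<open>N * \<mu> / L\<close> turns around a cycle of length \<open>L\<close> give
  the required counts. The error \<open>s + L\<close> consists of the starting word, of length
  \<open>s\<close>, and of rounding to complete turns.\<close>

lemma realisable_cycle:
  assumes es: "simple_cycle n k es" and n: "1 \<le> n" and k: "1 \<le> k" and \<mu>: "0 \<le> \<mu>"
  shows "realisable n k (\<lambda>\<pi>. \<mu> * Pi_forget n k (cycvec es) \<pi>) \<mu>"
proof -
  obtain h where h: "k = Suc h" using k by (cases k) auto
  define L where "L = length es"
  have L: "0 < L" using es by (simp add: simple_cycle_def L_def)
  have sub: "set es \<subseteq> Cinh n (Suc h)" and vert: "be h (es ! 0) \<in> Cinh n h"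
    and step: "\<And>i. i < L \<Longrightarrow> en h (es ! i) = be h (es ! ((i + 1) mod L))"
    using es L by (auto simp: simple_cycle_def h L_def)
  obtain xs0 cs0 where x0: "ritmo_word n xs0 cs0" "{1..<n} \<subseteq> set cs0" "h \<le> length xs0"
      "window h (length xs0 - h) xs0 cs0 = be h (es ! 0)"
    using realise_start[OF vert n] .
  define s where "s = length xs0"
  show ?thesis unfolding realisable_def
  proof (intro exI[of _ "real (s + L)"] allI)
    fix N :: nat
    define r where "r = nat \<lfloor>real N * \<mu> / real L\<rfloor>"
    have "0 \<le> real N * \<mu> / real L" using \<mu> by simp
    then have r: "real r \<le> real N * \<mu> / real L" "real N * \<mu> / real L < real r + 1"
      unfolding r_def by (simp_all add: of_nat_floor)
    define W where "W = map (\<lambda>t. es ! (t mod L)) [0..<r * L]"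
    have lenW: "length W = r * L" by (simp add: W_def)
    have "set W \<subseteq> Cinh n (Suc h)" using sub L by (auto simp: W_def L_def)
    moreover have "window h (length xs0 - h) xs0 cs0 = be h (W ! 0)" if "W \<noteq> []"
      using x0(4) that by (simp add: W_def)
    moreover have "en h (W ! i) = be h (W ! Suc i)" if "Suc i < length W" for i
      using that step[of "i mod L"] L by (simp add: W_def mod_Suc_eq)
    ultimately obtain xs cs where x: "ritmo_word n xs cs" "length xs = s + r * L"
      and win: "\<And>i. i < r * L \<Longrightarrow> window (Suc h) (s - h + i) xs cs = es ! (i mod L)"
      using realise_walk[OF x0(1-3) n, of W] unfolding lenW s_def by (auto simp: W_def)
    have occ: "\<bar>real (occ k \<pi> xs) - real N * (\<mu> * Pi_forget n k (cycvec es) \<pi>)\<bar> \<le> real (s + L)" for \<pi>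
    proof -
      define m where "m = card {t. t < L \<and> fst (es ! t) = \<pi>}"
      have mL: "m \<le> L" unfolding m_def using card_mono[of "{..<L}" "{t. t < L \<and> fst (es ! t) = \<pi>}"] by auto
      define P where "P = {i. i + k \<le> length xs \<and> std (take k (drop i xs)) = \<pi>}"
      \<comment> \<open>\<open>Q\<close> holds the matching starts among the windows produced by the
        walk; every other start in \<open>P\<close> precedes \<open>s - h\<close>.\<close>
      define Q where "Q = (+) (s - h) ` {t. t < r * L \<and> fst (es ! (t mod L)) = \<pi>}"
      have "card Q = r * m"
        using card_mod_periodic[OF L, of r "\<lambda>t. fst (es ! t) = \<pi>"] by (simp add: Q_def card_image m_def)
      have PQ: "s - h + t \<in> P \<longleftrightarrow> fst (es ! (t mod L)) = \<pi>" if t: "t < r * L" for t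
        using arg_cong[OF win[OF t], of fst] t x0(3) x(2) by (auto simp: P_def window_def h s_def)
      have "Q \<subseteq> P" using PQ by (auto simp: Q_def)
      moreover have "P \<subseteq> Q \<union> {..<s}"
      proof
        fix i assume i: "i \<in> P"
        show "i \<in> Q \<union> {..<s}"
        proof (cases "i < s - h")
          case False
          define t where "t = i - (s - h)"
          have "i = s - h + t" using False by (simp add: t_def)
          moreover have "t < r * L" using i x0(3) x(2) False by (auto simp: P_def h s_def t_def)
          ultimately show ?thesis using i PQ[of t] by (auto simp: Q_def)
        qed auto
      qed
      moreover have "finite P" by (rule finite_subset[of _ "{..length xs}"]) (auto simp: P_def)
      moreover have "finite Q" by (simp add: Q_def)
      ultimately have "card Q \<le> card P" "card P \<le> card Q + s"
        using card_mono[of P Q] card_mono[of "Q \<union> {..<s}" P] card_Un_le[of Q "{..<s}"] by auto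
      then have o: "real r * real m \<le> real (occ k \<pi> xs)" "real (occ k \<pi> xs) \<le> real r * real m + real s"
        using \<open>card Q = r * m\<close> by (simp_all add: occ_def P_def flip: of_nat_mult of_nat_add)
      have v: "real N * (\<mu> * Pi_forget n k (cycvec es) \<pi>) = (real N * \<mu> / real L) * real m"
        using Pi_forget_cycvec[OF sub n, of \<pi>] by (simp add: h m_def L_def)
      have "real r * real m \<le> (real N * \<mu> / real L) * real m"
        using r by (intro mult_right_mono) auto
      moreover have "(real N * \<mu> / real L) * real m \<le> (real r + 1) * real m"
        using r by (intro mult_right_mono) auto
      ultimately show ?thesis unfolding v using o mL by (simp add: distrib_right)
    qed
    have "\<bar>real (length xs) - real N * \<mu>\<bar> \<le> real (s + L)"
      using r L x(2) by (simp add: field_simps)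
    then show "\<exists>xs cs. ritmo_word n xs cs \<and> \<bar>real (length xs) - real N * \<mu>\<bar> \<le> real (s + L) \<and>
      (\<forall>\<pi>. \<bar>real (occ k \<pi> xs) - real N * (\<mu> * Pi_forget n k (cycvec es) \<pi>)\<bar> \<le> real (s + L))"
      using x(1) occ by blast
  qed
qed

lemma tendsto_of_linear_error:
  fixes f :: "nat \<Rightarrow> real"
  assumes "\<And>N. \<bar>f N - real N * a\<bar> \<le> K"
  shows "(\<lambda>N. f N / real N) \<longlonglongrightarrow> a"
proof (rule LIM_zero_cancel, rule Lim_null_comparison)
  show "\<forall>\<^sub>F N in sequentially. norm (f N / real N - a) \<le> K / real N"
    using eventually_gt_at_top[of 0]
  proof eventually_elim
    case (elim N)
    then have "f N / real N - a = (f N - real N * a) / real N" by (simp add: field_simps)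
    then show ?case using assms[of N] elim by (simp add: divide_right_mono)
  qed
  show "(\<lambda>N. K / real N) \<longlonglongrightarrow> 0" by (rule lim_const_over_n)
qed

lemma realisable_in_PAv:
  assumes "realisable n k v 1" "1 \<le> n" "1 \<le> k" "\<And>\<pi>. \<pi> \<notin> Sn k \<Longrightarrow> v \<pi> = 0"
  shows "v \<in> PAv n k"
proof -
  obtain K where K: "\<And>N::nat. \<exists>xs cs. ritmo_word n xs cs \<and>
     \<bar>real (length xs) - real N * 1\<bar> \<le> K \<and> (\<forall>\<pi>. \<bar>real (occ k \<pi> xs) - real N * v \<pi>\<bar> \<le> K)"
    using assms(1) unfolding realisable_def by blast
  then obtain xs cs where x: "\<And>N. ritmo_word n (xs N) (cs N)"
    "\<And>N. \<bar>real (length (xs N)) - real N * 1\<bar> \<le> K"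
    "\<And>N \<pi>. \<bar>real (occ k \<pi> (xs N)) - real N * v \<pi>\<bar> \<le> K" by metis
  \<comment> \<open>Skipping \<open>N0\<close> words makes the length of the m-th remaining word
    exceed \<open>m\<close>: the words are nonempty and their lengths tend to infinity. The added 1
    keeps \<open>m + N0\<close> positive, so it cancels in the quotient below.\<close>
  define N0 where "N0 = nat \<lceil>K\<rceil> + 1"
  define s where "s m = std (xs (m + N0))" for m
  have d: "distinct (xs N)" for N using x(1)[of N] by (simp add: ritmo_word_def)
  have K0: "real m < real (length (xs (m + N0)))" for m
    using x(2)[of "m + N0"] unfolding N0_def by (simp add: abs_le_iff) linarith
  have ls: "length (s m) = length (xs (m + N0))" for m by (simp add: s_def)
  have "s m \<in> AvAll n" for m
  proof -
    have "s m \<in> Av n (length (xs (m + N0)))"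
      unfolding s_def by (rule std_ritmo_word_in_Av[OF x(1) assms(2)])
    moreover have "length (xs (m + N0)) \<ge> 1" using K0[of m] by linarith
    ultimately show ?thesis unfolding AvAll_def by blast
  qed
  moreover have "filterlim (\<lambda>m. length (s m)) at_top sequentially"
  proof (rule filterlim_at_top_mono[OF filterlim_ident])
    show "\<forall>\<^sub>F m in sequentially. m \<le> length (s m)"
      using K0 by (intro always_eventually allI) (simp add: ls less_imp_le)
  qed
  moreover have lim: "(\<lambda>m. cocc \<pi> (s m)) \<longlonglongrightarrow> v \<pi>" if \<pi>: "\<pi> \<in> Sn k" for \<pi>
  proof -
    have lk: "length \<pi> = k" using \<pi> perm_of_length by (simp add: Sn_def)
    \<comment> \<open>Occurrences and length are both divided by \<open>N\<close>; the second
      quotient tends to the total weight 1.\<close>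
    have "(\<lambda>N. (real (occ k \<pi> (xs N)) / real N) / (real (length (xs N)) / real N)) \<longlonglongrightarrow> v \<pi> / 1"
      by (intro tendsto_divide tendsto_of_linear_error[where K = K] x) simp
    then have "(\<lambda>m. (real (occ k \<pi> (xs (m + N0))) / real (m + N0)) / (real (length (xs (m + N0))) / real (m + N0))) \<longlonglongrightarrow> v \<pi> / 1"
      by (rule LIMSEQ_ignore_initial_segment)
    moreover have "(real (occ k \<pi> (xs (m + N0))) / real (m + N0)) / (real (length (xs (m + N0))) / real (m + N0)) = cocc \<pi> (s m)" for m
      unfolding cocc_eq_occ[OF lk] s_def occ_std[OF d] by (simp add: N0_def)
    ultimately show ?thesis by simp
  qed
  moreover have "0 \<le> v \<pi> \<and> v \<pi> \<le> 1" if \<pi>: "\<pi> \<in> Sn k" for \<pi>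
  proof
    show "0 \<le> v \<pi>" by (rule LIMSEQ_le_const[OF lim[OF \<pi>]]) (simp add: cocc_def)
    have le: "cocc \<pi> (s m) \<le> 1" for m
    proof -
      have "{i. i + length \<pi> \<le> length (s m) \<and> pat {i..<i + length \<pi>} (s m) = \<pi>} \<subseteq> {..<length (s m)}"
        using assms(3) \<pi> perm_of_length by (auto simp: Sn_def)
      then have "card {i. i + length \<pi> \<le> length (s m) \<and> pat {i..<i + length \<pi>} (s m) = \<pi>} \<le> length (s m)"
        using card_mono[of "{..<length (s m)}"] by fastforce
      then show ?thesis by (simp add: cocc_def divide_le_eq_1)
    qed
    show "v \<pi> \<le> 1" by (rule LIMSEQ_le_const2[OF lim[OF \<pi>]]) (use le in auto)
  qed
  ultimately show ?thesis using assms(4) unfolding PAv_def by blast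
qed

lemma cycle_polytope_subset_PAv:
  assumes n: "1 \<le> n" and k: "1 \<le> k" and w: "w \<in> cycle_polytope n k"
  shows "Pi_forget n k w \<in> PAv n k"
proof -
  obtain X \<mu> where X: "finite X" "X \<subseteq> cycvec ` {es. simple_cycle n k es}"
      "\<forall>x\<in>X. 0 \<le> \<mu> x" "sum \<mu> X = 1" "w = (\<lambda>e. \<Sum>x\<in>X. \<mu> x * x e)"
    using w unfolding cycle_polytope_def by blast
  \<comment> \<open>The total stays \<open>sum \<mu> X\<close> because partial sums of the weights
    need not be 1 during the induction.\<close>
  have "realisable n k (\<lambda>\<pi>. \<Sum>x\<in>X. \<mu> x * Pi_forget n k x \<pi>) (sum \<mu> X)"
    using X(1-3)
  proof (induction X rule: finite_induct)
    case empty
    then show ?case using realisable_zero[OF k] by simp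
  next
    case (insert x X)
    obtain es where es: "simple_cycle n k es" "x = cycvec es" using insert by auto
    have "realisable n k (\<lambda>\<pi>. \<mu> x * Pi_forget n k x \<pi>) (\<mu> x)"
      unfolding es(2) using insert.prems es by (intro realisable_cycle n k) auto
    from realisable_add[OF this _ k] insert show ?case by simp
  qed
  moreover have "(\<lambda>\<pi>. \<Sum>x\<in>X. \<mu> x * Pi_forget n k x \<pi>) = Pi_forget n k w"
    unfolding Pi_forget_def X(5) by (subst sum.swap) (simp add: sum_distrib_left)
  moreover have "Pi_forget n k w \<pi> = 0" if "\<pi> \<notin> Sn k" for \<pi>
  proof -
    have "{e \<in> Cinh n k. fst e = \<pi>} = {}" using that Cinh_fst_in_Sn by blast
    then show ?thesis by (simp only: Pi_forget_def sum.empty)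
  qed
  ultimately show ?thesis using realisable_in_PAv[OF _ n k] X(4) by simp
qed

section \<open>Limits of window frequencies\<close>

lemma finite_common_subsequence:
  fixes f :: "nat \<Rightarrow> 'a \<Rightarrow> real"
  assumes "finite A" "\<And>m a. a \<in> A \<Longrightarrow> f m a \<in> {0..1}"
  shows "\<exists>r l. strict_mono (r :: nat \<Rightarrow> nat) \<and> (\<forall>a\<in>A. (\<lambda>m. f (r m) a) \<longlonglongrightarrow> l a)"
  using assms
proof (induction A rule: finite_induct)
  case empty
  show ?case by (intro exI[of _ id]) (simp add: strict_mono_def)
next
  case (insert a A)
  then obtain r l where r: "strict_mono (r :: nat \<Rightarrow> nat)" "\<forall>b\<in>A. (\<lambda>m. f (r m) b) \<longlonglongrightarrow> l b"
    by auto
  have "seq_compact {0..1::real}" by (rule compact_imp_seq_compact[OF compact_Icc])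
  moreover have "\<forall>m. f (r m) a \<in> {0..1}" using insert.prems by auto
  ultimately obtain c q where "c \<in> {0..1}" and
    q: "strict_mono (q :: nat \<Rightarrow> nat)" "((\<lambda>m. f (r m) a) \<circ> q) \<longlonglongrightarrow> c"
    by (rule seq_compactE)
  have "(\<lambda>m. f ((r \<circ> q) m) b) \<longlonglongrightarrow> (l(a := c)) b" if "b \<in> insert a A" for b
  proof (cases "b = a")
    case True
    then show ?thesis using q(2) by (simp add: comp_def)
  next
    case False
    then have "(\<lambda>m. f (r m) b) \<longlonglongrightarrow> l b" using r that by auto
    from LIMSEQ_subseq_LIMSEQ[OF this q(1)] show ?thesis using False by (simp add: comp_def)
  qed
  then show ?case using strict_mono_o[OF r(1) q(1)]
    by (intro exI[of _ "r \<circ> q"] exI[of _ "l(a := c)"]) (simp add: comp_def)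
qed

lemma sum_card_fibres:
  assumes "finite I" "finite E" "g ` I \<subseteq> E"
  shows "(\<Sum>e\<in>{e\<in>E. Q e}. card {i\<in>I. g i = e}) = card {i\<in>I. Q (g i)}"
proof -
  have "(\<Sum>e\<in>{e\<in>E. Q e}. sum (\<lambda>_. 1::nat) {i\<in>{i\<in>I. Q (g i)}. g i = e}) = sum (\<lambda>_. 1) {i\<in>I. Q (g i)}"
    using assms by (intro sum.group) auto
  moreover have "{i\<in>{i\<in>I. Q (g i)}. g i = e} = {i\<in>I. g i = e}" if "Q e" for e using that by auto
  ultimately show ?thesis by (simp only: card_eq_sum) simp
qed

text \<open>Shifting an interval by one loses one end and gains the other. For the vertices visited
  by a walk this is flow conservation up to one unit.\<close>

lemma card_shift_diff:
  "\<bar>real (card {i\<in>{..<c::nat}. P i}) - real (card {i\<in>{..<c}. P (Suc i)})\<bar> \<le> 1"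
proof -
  have S: "card (Suc ` {i\<in>{..<c}. P (Suc i)}) = card {i\<in>{..<c}. P (Suc i)}" by (simp add: card_image)
  have "{i\<in>{..<c}. P i} \<subseteq> insert 0 (Suc ` {i\<in>{..<c}. P (Suc i)})"
  proof
    fix i assume "i \<in> {i\<in>{..<c}. P i}"
    then show "i \<in> insert 0 (Suc ` {i\<in>{..<c}. P (Suc i)})" by (cases i) auto
  qed
  then have "card {i\<in>{..<c}. P i} \<le> card (insert 0 (Suc ` {i\<in>{..<c}. P (Suc i)}))"
    by (intro card_mono) auto
  also have "\<dots> = Suc (card {i\<in>{..<c}. P (Suc i)})"
    by (subst card_insert_disjoint) (auto simp: card_image)
  finally have 1: "card {i\<in>{..<c}. P i} \<le> Suc (card {i\<in>{..<c}. P (Suc i)})" .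
  have "Suc ` {i\<in>{..<c}. P (Suc i)} \<subseteq> insert c {i\<in>{..<c}. P i}" by auto
  then have "card (Suc ` {i\<in>{..<c}. P (Suc i)}) \<le> card (insert c {i\<in>{..<c}. P i})"
    by (intro card_mono) auto
  also have "\<dots> = Suc (card {i\<in>{..<c}. P i})" by simp
  finally show ?thesis using 1 S by linarith
qed

lemma be_in_Cinh:
  assumes "e \<in> Cinh n k" "1 \<le> n" "j \<le> k"
  shows "be j e \<in> Cinh n j"
proof -
  obtain xs cs where x: "ritmo_word n xs cs" "k \<le> length xs" "xs \<noteq> []" "e = window k (length xs - k) xs cs"
    using CinhE[OF assms(1,2)] .
  then have "be j e = window j (length xs - k) xs cs"
    using assms(3) by (simp add: be_window ritmo_word_def)
  then show ?thesis using window_in_Cinh[OF x(1) _ x(3) assms(2), of "length xs - k" j] x(2) assms(3) by simp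
qed

lemma circulation_in_cycle_polytope:
  fixes w :: "cperm \<Rightarrow> real"
  assumes n: "1 \<le> n"
    and "\<And>e. 0 \<le> w e" "\<And>e. e \<notin> Cinh n k \<Longrightarrow> w e = 0"
    and "\<And>u. (\<Sum>e\<in>{e\<in>Cinh n k. be (k - 1) e = u}. w e) = (\<Sum>e\<in>{e\<in>Cinh n k. en (k - 1) e = u}. w e)"
    and total: "sum w (Cinh n k) = 1"
  shows "w \<in> cycle_polytope n k"
proof -
  let ?S = "{es. es \<noteq> [] \<and> set es \<subseteq> Cinh n k \<and> cyclic_walk (be (k - 1)) (en (k - 1)) es \<and>
     distinct (map (be (k - 1)) es)}"
  have "w \<in> conic_hull ((\<lambda>es e. real (count_list es e) / real (length es)) ` ?S)"
    by (rule circulation_in_conic_hull[OF finite_Cinh[OF n] assms(2-4)])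
  then have "w \<in> conic_hull (cycvec ` ?S)" by (simp only: cycvec_def[abs_def])
  then obtain X \<mu> where X: "finite X" "X \<subseteq> cycvec ` ?S" "\<forall>x\<in>X. 0 \<le> \<mu> x"
      "w = (\<lambda>e. \<Sum>x\<in>X. \<mu> x * x e)"
    unfolding conic_hull_def by blast
  have simple: "simple_cycle n k es" if "es \<in> ?S" for es
  proof -
    have "set (map (be (k - 1)) es) \<subseteq> Cinh n (k - 1)" using that be_in_Cinh[OF _ n, of _ k "k - 1"] by auto
    then show ?thesis using that by (simp add: simple_cycle_def cyclic_walk_def distinct_map)
  qed
  \<comment> \<open>Each cycle vector has mass 1, so the mass of \<open>w\<close> equals the sum of
    the weights.\<close>
  have "sum x (Cinh n k) = 1" if x: "x \<in> X" for x
  proof -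
    obtain es where es: "x = cycvec es" "es \<noteq> []" "set es \<subseteq> Cinh n k" using X(2) x by blast
    have "(\<Sum>e\<in>Cinh n k. real (count_list es e)) = real (length es)"
      using arg_cong[OF sum_count_set[OF es(3) finite_Cinh[OF n]], of real] by (simp only: of_nat_sum)
    then show ?thesis using es(2) by (simp add: es(1) cycvec_def sum_divide_distrib[symmetric])
  qed
  then have "(\<Sum>x\<in>X. \<mu> x * sum x (Cinh n k)) = sum \<mu> X" by simp
  moreover have "sum w (Cinh n k) = (\<Sum>x\<in>X. \<mu> x * sum x (Cinh n k))"
    unfolding X(4) by (subst sum.swap) (simp add: sum_distrib_left)
  ultimately have "sum \<mu> X = 1" using total by simp
  moreover have "X \<subseteq> cycvec ` {es. simple_cycle n k es}" using X(2) simple by blast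
  ultimately show ?thesis using X unfolding cycle_polytope_def by blast
qed

lemma PAv_subset_cycle_polytope:
  assumes n: "1 \<le> n" and k: "1 \<le> k" and v: "v \<in> PAv n k"
  shows "v \<in> Pi_forget n k ` cycle_polytope n k"
proof -
  obtain s where s: "\<And>m. s m \<in> AvAll n" "filterlim (\<lambda>m. length (s m)) at_top sequentially"
      "\<And>\<pi>. \<pi> \<in> Sn k \<Longrightarrow> (\<lambda>m. cocc \<pi> (s m)) \<longlonglongrightarrow> v \<pi>"
    and v0: "\<And>\<pi>. \<pi> \<notin> Sn k \<Longrightarrow> v \<pi> = 0"
    using v unfolding PAv_def by blast
  define cs where "cs m = map (ritmo (s m)) [0..<length (s m)]" for m
  have d: "distinct (s m)" and word: "ritmo_word n (s m) (cs m)" and ne: "s m \<noteq> []" for m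
  proof -
    obtain M where M: "1 \<le> M" "s m \<in> Av n M" using s(1)[of m] by (auto simp: AvAll_def)
    then show "distinct (s m)" by (simp add: Av_def perm_of_def)
    then show "ritmo_word n (s m) (cs m)"
      unfolding cs_def using M n by (intro avoids_ritmo_word) (auto simp: Av_def)
    show "s m \<noteq> []" using M perm_of_length by (force simp: Av_def)
  qed
  define E where "E = Cinh n k"
  have finE: "finite E" unfolding E_def by (rule finite_Cinh[OF n])
  \<comment> \<open>Starts of complete windows; truncated subtraction leaves none if the permutation
    is shorter than \<open>k\<close>.\<close>
  define I where "I m = {..<length (s m) + 1 - k}" for m
  have I_iff: "i \<in> I m \<longleftrightarrow> i + k \<le> length (s m)" for i m by (auto simp: I_def)
  have finI: "finite (I m)" for m by (simp add: I_def)
  define g where "g m i = window k i (s m) (cs m)" for m i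
  have gE: "g m ` I m \<subseteq> E" for m
    using window_in_Cinh[OF word _ ne n] by (auto simp: I_iff g_def E_def)
  \<comment> \<open>The divisor is the length, as in \<open>cocc\<close>, not the number of windows,
    so the total mass reaches 1 in the limit.\<close>
  define f where "f m e = real (card {i\<in>I m. g m i = e}) / real (length (s m))" for m e
  \<comment> \<open>The predicate \<open>Q\<close> will test the source, the target, nothing at all,
    and the underlying pattern of an edge.\<close>
  have sum_f: "(\<Sum>e\<in>{e\<in>E. Q e}. f m e) = real (card {i\<in>I m. Q (g m i)}) / real (length (s m))" for m Q
    using arg_cong[OF sum_card_fibres[OF finI[of m] finE gE[of m], of Q], of real]
    by (simp add: f_def sum_divide_distrib[symmetric])
  have cardI: "card (I m) \<le> length (s m)" for m using k by (simp add: I_def)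
  have "f m e \<in> {0..1}" for m e
    using card_mono[OF finI[of m], of "{i\<in>I m. g m i = e}"] cardI[of m]
    by (auto simp: f_def divide_le_eq_1)
  with finite_common_subsequence[OF finE, of f] obtain r l where
    r: "strict_mono r" and l: "\<And>e. e \<in> E \<Longrightarrow> (\<lambda>m. f (r m) e) \<longlonglongrightarrow> l e" by blast
  define w where "w e = (if e \<in> E then l e else 0)" for e
  have lim_sum: "(\<lambda>m. \<Sum>e\<in>{e\<in>E. Q e}. f (r m) e) \<longlonglongrightarrow> (\<Sum>e\<in>{e\<in>E. Q e}. w e)" for Q
    by (intro tendsto_sum) (use l in \<open>auto simp: w_def\<close>)
  have len_lim: "filterlim (\<lambda>m. real (length (s (r m)))) at_top sequentially"
    using filterlim_compose[OF filterlim_real_sequentially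
        filterlim_compose[OF s(2) filterlim_subseq[OF r]]] .
  have vanish: "(\<lambda>m. K / real (length (s (r m)))) \<longlonglongrightarrow> 0" for K
    by (rule tendsto_divide_0[OF tendsto_const filterlim_at_top_imp_at_infinity[OF len_lim]])
  have "w \<in> cycle_polytope n k"
  proof (rule circulation_in_cycle_polytope[OF n])
    show "0 \<le> w e" for e
    proof (cases "e \<in> E")
      case True
      have "0 \<le> l e" by (rule LIMSEQ_le_const[OF l[OF True]]) (simp add: f_def)
      then show ?thesis by (simp add: w_def)
    qed (simp add: w_def)
    show "w e = 0" if "e \<notin> Cinh n k" for e using that by (simp add: w_def E_def)
    show "(\<Sum>e\<in>{e\<in>Cinh n k. be (k - 1) e = u}. w e) = (\<Sum>e\<in>{e\<in>Cinh n k. en (k - 1) e = u}. w e)" for u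
    proof -
      define V where "V m i = window (k - 1) i (s m) (cs m)" for m i
      have be: "be (k - 1) (g m i) = V m i" for m i
        using be_window[OF d] by (simp add: g_def V_def)
      \<comment> \<open>The last \<open>k - 1\<close> entries of the window at \<open>i\<close>
        start at \<open>i + 1\<close>, so outflow and inflow at \<open>u\<close> differ only by a
        shift of the index.\<close>
      have en: "en (k - 1) (g m i) = V m (Suc i)" if "i \<in> I m" for m i
        using en_window[OF d ritmo_word_length[OF word], of i k m "k - 1"] that k
        by (simp add: g_def V_def I_iff)
      have "norm ((\<Sum>e\<in>{e\<in>E. be (k - 1) e = u}. f m e) - (\<Sum>e\<in>{e\<in>E. en (k - 1) e = u}. f m e))
          \<le> 1 / real (length (s m))" for m
      proof -
        have "{i\<in>I m. en (k - 1) (g m i) = u} = {i\<in>I m. V m (Suc i) = u}" using en by auto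
        then have "(\<Sum>e\<in>{e\<in>E. be (k - 1) e = u}. f m e) - (\<Sum>e\<in>{e\<in>E. en (k - 1) e = u}. f m e) =
          (real (card {i\<in>I m. V m i = u}) - real (card {i\<in>I m. V m (Suc i) = u})) / real (length (s m))"
          by (simp only: sum_f be diff_divide_distrib)
        moreover have "\<bar>real (card {i\<in>I m. V m i = u}) - real (card {i\<in>I m. V m (Suc i) = u})\<bar> \<le> 1"
          unfolding I_def by (rule card_shift_diff)
        ultimately show ?thesis by (simp add: divide_right_mono)
      qed
      then have "(\<lambda>m. (\<Sum>e\<in>{e\<in>E. be (k - 1) e = u}. f (r m) e) - (\<Sum>e\<in>{e\<in>E. en (k - 1) e = u}. f (r m) e))
          \<longlonglongrightarrow> 0"
        by (intro Lim_null_comparison[OF always_eventually vanish[of 1]] allI)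
      from LIMSEQ_unique[OF this tendsto_diff[OF lim_sum lim_sum]] show ?thesis by (simp add: E_def)
    qed
    show "sum w (Cinh n k) = 1"
    proof -
      have "norm ((\<Sum>e\<in>{e\<in>E. True}. f m e) - 1) \<le> real k / real (length (s m))" for m
      proof -
        have L: "0 < real (length (s m))" using ne[of m] by simp
        have "(\<Sum>e\<in>{e\<in>E. True}. f m e) - 1 = (real (card (I m)) - real (length (s m))) / real (length (s m))"
          unfolding sum_f using L by (simp add: field_simps)
        moreover have "\<bar>real (card (I m)) - real (length (s m))\<bar> \<le> real k"
          using cardI[of m] by (simp add: I_def)
        ultimately show ?thesis by (simp add: divide_right_mono)
      qed
      then have "(\<lambda>m. (\<Sum>e\<in>{e\<in>E. True}. f (r m) e) - 1) \<longlonglongrightarrow> 0"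
        by (intro Lim_null_comparison[OF always_eventually vanish[of "real k"]] allI)
      from LIMSEQ_unique[OF LIM_zero_cancel[OF this] lim_sum[of "\<lambda>_. True"]]
      show ?thesis by (simp add: E_def)
    qed
  qed
  moreover have "Pi_forget n k w = v"
  proof
    fix \<pi>
    show "Pi_forget n k w \<pi> = v \<pi>"
    proof (cases "\<pi> \<in> Sn k")
      case True
      then have lk: "length \<pi> = k" using perm_of_length by (simp add: Sn_def)
      have "(\<Sum>e\<in>{e\<in>E. fst e = \<pi>}. f m e) = cocc \<pi> (s m)" for m
      proof -
        have "{i\<in>I m. fst (g m i) = \<pi>} = {i. i + k \<le> length (s m) \<and> std (take k (drop i (s m))) = \<pi>}"
          by (auto simp: I_iff g_def window_def)
        then show ?thesis by (simp add: sum_f cocc_eq_occ[OF lk] occ_def)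
      qed
      then have "(\<lambda>m. cocc \<pi> (s (r m))) \<longlonglongrightarrow> Pi_forget n k w \<pi>"
        using lim_sum[of "\<lambda>e. fst e = \<pi>"] by (simp add: Pi_forget_def E_def)
      from LIMSEQ_unique[OF this] show ?thesis
        using LIMSEQ_subseq_LIMSEQ[OF s(3)[OF True] r] by (simp add: comp_def)
    next
      case False
      then have "{e \<in> Cinh n k. fst e = \<pi>} = {}" using Cinh_fst_in_Sn by blast
      then show ?thesis using v0[OF False] by (simp only: Pi_forget_def sum.empty)
    qed
  qed
  ultimately show ?thesis by blast
qed

theorem mainTheorem7:
  fixes n k :: nat
  assumes "2 \<le> n" and "1 \<le> k"
  shows "PAv n k = Pi_forget n k ` cycle_polytope n k"
proof -
  have n: "1 \<le> n" using assms by simp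
  show ?thesis
    using PAv_subset_cycle_polytope[OF n assms(2)] cycle_polytope_subset_PAv[OF n assms(2)] by blast
qed

end
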